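(* Let $d \geq 2$ be an integer and $T$ a tree of order $n$ with $\ell$ leaves. If $n-\ell \geq d$, then $\gamma_d^1(T) \leq \frac{n-\ell}{d}$, with equality if and only if $T \in \mathcal{F}_d$.
   Context: $\gamma_d^1(G)$ is the minimum size of an independent set $S\subseteq V(G)$ such that every vertex not in $S$ is at distance at most $d$ from some vertex of $S$. $L(T)$ denotes the set of leaves of $T$; $P_k$ the path on $k$ vertices; a support vertex is a vertex adjacent to a leaf. For $k\ge1$, $T^*\circ P_k$ is obtained from $T^*$ by attaching to each vertex $v$ of $T^*$ its own new copy of $P_k$ via an edge from $v$ to an end vertex of the copy, and $\mathcal{T}_k=\{T^*\circ P_k: T^*\text{ a tree with at least two vertices}\}$. The family $\zeta_1$ of trees is defined recursively: $K_2\in\zeta_1$; if $T'\in\zeta_1$ and $T$ is obtained by joining the center of a new copy of $K_{1,t}$ ($t\ge 1$) by an edge to a support vertex $v$ of $T'$ and adding $t-1$ new leaves adjacent to $v$, then $T\in\zeta_1$ (both vertices of $K_2$ count as support vertices). Define $\mathcal{F}_2=\{T \text{ tree}: T-L(T)\in\zeta_1\}$ and, for $d\ge 3$, $\mathcal{F}_d=\{T \text{ tree}: T-L(T) \text{ is a tree of order } d \text{ or belongs to } \mathcal{T}_{d-1}\}$. *)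

theory Defs
  imports "Graph_Theory.Graph_Theory"
begin

(* A finite simple graph is a pair_graph: a finite, loopless digraph whose arc relation is
   symmetric, each edge {u,v} being the two arcs (u,v) and (v,u). *)

(* The predicate tree of Graph_Theory forbids all directed cycles, hence also the closed walk
   u, v, u along an edge, and is unsuitable here.  A cycle of a simple graph is a directed
   cycle of length at least 3. *)
definition is_tree :: "'a pair_pre_digraph \<Rightarrow> bool" where
  "is_tree G \<longleftrightarrow> pair_graph G \<and> connected (with_proj G) \<and>
     \<not> (\<exists>p. pre_digraph.cycle (with_proj G) p \<and> length p \<ge> 3)"

definition leaves :: "'a pair_pre_digraph \<Rightarrow> 'a set" where
  "leaves G = {v \<in> pverts G. out_degree (with_proj G) v = 1}"

definition support_verts :: "'a pair_pre_digraph \<Rightarrow> 'a set" where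
  "support_verts G = {v \<in> pverts G. \<exists>u \<in> leaves G. (v, u) \<in> parcs G}"

definition remove_verts :: "'a pair_pre_digraph \<Rightarrow> 'a set \<Rightarrow> 'a pair_pre_digraph" where
  "remove_verts G X = \<lparr>pverts = pverts G - X,
     parcs = {(u, v) \<in> parcs G. u \<notin> X \<and> v \<notin> X}\<rparr>"

definition independent_set :: "'a pair_pre_digraph \<Rightarrow> 'a set \<Rightarrow> bool" where
  "independent_set G S \<longleftrightarrow> S \<subseteq> pverts G \<and> (\<forall>u \<in> S. \<forall>v \<in> S. (u, v) \<notin> parcs G)"

definition graph_dist :: "'a pair_pre_digraph \<Rightarrow> 'a \<Rightarrow> 'a \<Rightarrow> ereal" where
  "graph_dist G u v = wf_digraph.\<mu> (with_proj G) (\<lambda>_. 1) u v"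

definition dist_dominating :: "nat \<Rightarrow> 'a pair_pre_digraph \<Rightarrow> 'a set \<Rightarrow> bool" where
  "dist_dominating d G S \<longleftrightarrow>
     (\<forall>v \<in> pverts G - S. \<exists>u \<in> S. graph_dist G v u \<le> ereal (real d))"

definition indep_dist_dom_number :: "nat \<Rightarrow> 'a pair_pre_digraph \<Rightarrow> nat" where
  "indep_dist_dom_number d G =
     (LEAST k. \<exists>S. independent_set G S \<and> dist_dominating d G S \<and> card S = k)"

(* H o P_k: the vertex v of H becomes (v,0), and (v,1), ..., (v,k) is the path attached to it. *)
definition attach_paths :: "'a pair_pre_digraph \<Rightarrow> nat \<Rightarrow> ('a \<times> nat) pair_pre_digraph" where
  "attach_paths H k = \<lparr>pverts = pverts H \<times> {0..k},
     parcs = {((u, 0), (v, 0)) | u v. (u, v) \<in> parcs H} \<union>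
       {((v, i), (v, j)) | v i j. v \<in> pverts H \<and> i \<le> k \<and> j \<le> k \<and> (j = Suc i \<or> i = Suc j)}\<rparr>"

(* No generality is lost by taking H over the same vertex type as G, since H embeds into G. *)
definition path_corona_family :: "nat \<Rightarrow> 'a pair_pre_digraph set" where
  "path_corona_family k = {G. \<exists>H :: 'a pair_pre_digraph. is_tree H \<and> card (pverts H) \<ge> 2 \<and>
     digraph_iso (with_proj (attach_paths H k)) (with_proj G)}"

(* c is the center and A the set of the t leaves of the new star K_{1,t};
   B is the set of the t - 1 new leaves at v. *)
definition zeta_extension ::
  "'a pair_pre_digraph \<Rightarrow> 'a \<Rightarrow> 'a \<Rightarrow> 'a set \<Rightarrow> 'a set \<Rightarrow> 'a pair_pre_digraph" where
  "zeta_extension G v c A B = (let E = {(v, c)} \<union> {c} \<times> A \<union> {v} \<times> B in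
     \<lparr>pverts = pverts G \<union> {c} \<union> A \<union> B, parcs = parcs G \<union> E \<union> E\<inverse>\<rparr>)"

(* Every graph with the shape required by a rule is admitted, whatever its vertices are, so the
   family is closed under isomorphism within the vertex type. *)
inductive_set zeta1 :: "'a pair_pre_digraph set" where
  base: "complete_digraph 2 (with_proj G) \<Longrightarrow> G \<in> zeta1"
| step: "\<lbrakk>G \<in> zeta1; v \<in> support_verts G; t \<ge> 1;
     finite A; card A = t; finite B; card B = t - 1;
     c \<notin> pverts G; A \<inter> pverts G = {}; B \<inter> pverts G = {};
     c \<notin> A; c \<notin> B; A \<inter> B = {}\<rbrakk>
     \<Longrightarrow> zeta_extension G v c A B \<in> zeta1"

(* Only meaningful for d at least 2. *)
definition extremal_family :: "nat \<Rightarrow> 'a pair_pre_digraph set" where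
  "extremal_family d = (if d = 2
     then {T. is_tree T \<and> remove_verts T (leaves T) \<in> zeta1}
     else {T. is_tree T \<and>
       (is_tree (remove_verts T (leaves T)) \<and> card (pverts (remove_verts T (leaves T))) = d \<or>
        remove_verts T (leaves T) \<in> path_corona_family (d - 1))})"

end

(*
Write m = n - l for the order of T - L(T). An independent set that dominates T - L(T) within
distance d - 1 dominates T within distance d.

Upper bound. Take a lowest vertex y of the rooted tree T - L(T) whose subtree S has at least d
vertices and level the rest R from the parent u of y. If the smallest level class modulo d of R
is not the class of u, it can be combined with y; otherwise the class of u is combined with those
children of y that have descendants at depth d - 1 in S. Counting vertices, one of the two sets
has at most m/d elements, and for d >= 3 equality forces R to be empty or S to have exactly d
vertices.

Extremal trees. For d >= 3 the remainder R is again extremal, and S has to be a path attached by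
its end to the foot of a path of R, since otherwise one vertex could be saved; thus T - L(T) is
built up as T* o P_(d-1). For d = 2 one peels off a star at the end of a longest path: if it has t
leaves, its neighbour v has at least t leaves, as otherwise the bound applied to the remaining
branches at v gives a dominating set that is too small.

Conversely, a leaf of T hanging at an end vertex of T - L(T) is only reached from its own branch.
For T* o P_(d-1) this gives one vertex per path; for the family zeta_1 it gives a count by
induction along the construction.
*)

theory Submission
  imports Defs
begin

section \<open>Rooted trees\<close>

text \<open>Climbing towards the root, a vertex meets every level class modulo d within d - 1 steps,
  except that class i misses the vertices of level below i. Class 0 has no exceptions. When
  \<open>R\<close> is joined to \<open>S\<close> by the edge from its root \<open>u\<close> to
  \<open>y\<close>, the exceptions for i > 0 are dominated by \<open>y\<close>: a vertex of level j
  < i climbs to \<open>u\<close> and crosses to \<open>y\<close> in j + 1 \<le> i \<le> d - 1 steps.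
  Class 0 is the only one containing \<open>u\<close>, hence the only one in conflict with
  \<open>y\<close>.

  Extremality is expressed on T - L(T) alone, as tightness: no independent set dominating it within
  d - 1 has fewer than m/d elements. This form passes to the piece left after cutting. The removed
  leaves return only for the lower bounds, where the radius is d.

  For d = 2 both candidate sets can be tight although \<open>S\<close> is a star with more than two
  vertices, so no piece of order d need split off. This is where the larger stars of
  \<open>zeta1\<close> and their t - 1 compensating leaves come from.\<close>

definition rooted_tree ::
  "'a set \<Rightarrow> ('a \<times> 'a) set \<Rightarrow> 'a \<Rightarrow> ('a \<Rightarrow> 'a) \<Rightarrow> ('a \<Rightarrow> nat) \<Rightarrow> bool" where
  "rooted_tree V E r p l \<longleftrightarrow> finite V \<and> r \<in> V \<and> l r = 0 \<and>
     (\<forall>x \<in> V - {r}. p x \<in> V \<and> l x = Suc (l (p x))) \<and>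
     E = {(x, y). x \<in> V \<and> y \<in> V \<and> (x \<noteq> r \<and> y = p x \<or> y \<noteq> r \<and> x = p y)}"

text \<open>The inductive form allows any vertex to be chosen as root and matches the growth of a
  maximal subtree; the rooted form is the one that restricts to subtrees. In
  \<open>rooted_tree\<close> the level drops by 1 at each parent, which forces every chain of
  parents to end at \<open>r\<close>.\<close>

inductive tree_on :: "'a set \<Rightarrow> ('a \<times> 'a) set \<Rightarrow> bool" where
  single: "tree_on {v} {}"
| add_leaf: "\<lbrakk>tree_on V E; u \<in> V; x \<notin> V\<rbrakk>
    \<Longrightarrow> tree_on (insert x V) (insert (u, x) (insert (x, u) E))"

lemma tree_on_basic:
  assumes "tree_on V E"
  shows "finite V" "V \<noteq> {}" "E \<subseteq> V \<times> V" "sym E" "irrefl E"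
  using assms by (induction) (auto simp: sym_def irrefl_def)

lemma tree_on_symD: "tree_on V E \<Longrightarrow> (x, y) \<in> E \<Longrightarrow> (y, x) \<in> E"
  using tree_on_basic(4) by (metis symE)

lemma rooted_treeD:
  assumes "rooted_tree V E r p l"
  shows "finite V" "r \<in> V" "l r = 0"
    and "\<And>x. x \<in> V \<Longrightarrow> x \<noteq> r \<Longrightarrow> p x \<in> V"
    and "\<And>x. x \<in> V \<Longrightarrow> x \<noteq> r \<Longrightarrow> l x = Suc (l (p x))"
    and "\<And>x y. (x, y) \<in> E \<longleftrightarrow> x \<in> V \<and> y \<in> V \<and> (x \<noteq> r \<and> y = p x \<or> y \<noteq> r \<and> x = p y)"
  using assms unfolding rooted_tree_def by auto

lemma rooted_tree_adj_level:
  assumes "rooted_tree V E r p l" "(x, y) \<in> E"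
  shows "l x = Suc (l y) \<or> l y = Suc (l x)"
  using rooted_treeD[OF assms(1)] assms(2) by metis

lemma rooted_tree_level_eq_0:
  assumes "rooted_tree V E r p l" "x \<in> V"
  shows "l x = 0 \<longleftrightarrow> x = r"
  using rooted_treeD[OF assms(1)] assms(2) by (metis nat.distinct(1))

lemma tree_on_imp_rooted_tree:
  assumes "tree_on V E" "r \<in> V"
  shows "\<exists>p l. rooted_tree V E r p l"
  using assms
proof (induction arbitrary: r)
  case (single v)
  then show ?case
    by (intro exI[of _ "\<lambda>x. x"] exI[of _ "\<lambda>_. 0"]) (auto simp: rooted_tree_def)
next
  case (add_leaf V E u x)
  show ?case
  proof (cases "r = x")
    case True
    \<comment> \<open>The root is the new leaf: the old tree is rooted at its neighbour
      \<open>u\<close>, every level is raised by 1, and \<open>x\<close> becomes the parent of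
      \<open>u\<close>.\<close>
    from add_leaf.IH[OF add_leaf.hyps(2)] obtain p l where R: "rooted_tree V E u p l" by blast
    note RD = rooted_treeD[OF R]
    have "rooted_tree (insert x V) (insert (u, x) (insert (x, u) E)) x
        (p(u := x)) ((\<lambda>z. Suc (l z))(x := 0))"
      unfolding rooted_tree_def
    proof (intro conjI)
      show "\<forall>z\<in>insert x V - {x}. (p(u := x)) z \<in> insert x V \<and>
          ((\<lambda>z. Suc (l z))(x := 0)) z = Suc (((\<lambda>z. Suc (l z))(x := 0)) ((p(u := x)) z))"
        using RD(3-5) add_leaf.hyps by (auto simp: RD(3-5))
      show "insert (u, x) (insert (x, u) E) = {(a, b). a \<in> insert x V \<and> b \<in> insert x V \<and>
          (a \<noteq> x \<and> b = (p(u := x)) a \<or> b \<noteq> x \<and> a = (p(u := x)) b)}" (is "?L = ?R")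
      proof (rule set_eqI, clarify)
        fix a b
        show "(a, b) \<in> ?L \<longleftrightarrow> (a, b) \<in> ?R"
          using add_leaf.hyps RD(2) RD(4)[of a] RD(4)[of b] by (cases "a = u"; cases "b = u"; auto simp: RD(6))
      qed
    qed (use RD(1,2) in auto)
    then show ?thesis using True by blast
  next
    case False
    with add_leaf.prems have "r \<in> V" by simp
    from add_leaf.IH[OF this] obtain p l where R: "rooted_tree V E r p l" by blast
    note RD = rooted_treeD[OF R]
    have "rooted_tree (insert x V) (insert (u, x) (insert (x, u) E)) r
        (p(x := u)) (l(x := Suc (l u)))"
      unfolding rooted_tree_def
    proof (intro conjI)
      show "\<forall>z\<in>insert x V - {r}. (p(x := u)) z \<in> insert x V \<and>
          (l(x := Suc (l u))) z = Suc ((l(x := Suc (l u))) ((p(x := u)) z))"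
        using RD(3-5) add_leaf.hyps by (auto simp: RD(3-5))
      show "insert (u, x) (insert (x, u) E) = {(a, b). a \<in> insert x V \<and> b \<in> insert x V \<and>
          (a \<noteq> r \<and> b = (p(x := u)) a \<or> b \<noteq> r \<and> a = (p(x := u)) b)}" (is "?L = ?R")
      proof (rule set_eqI, clarify)
        fix a b
        show "(a, b) \<in> ?L \<longleftrightarrow> (a, b) \<in> ?R"
          using add_leaf.hyps False RD(2) RD(4)[of a] RD(4)[of b] by (cases "a = x"; cases "b = x"; auto simp: RD(6))
      qed
    qed (use RD(1-3) \<open>r \<in> V\<close> False in auto)
    then show ?thesis by blast
  qed
qed

text \<open>A vertex of maximal level is nobody's parent, so it can be removed; it goes back as the
  leaf added last.\<close>

lemma rooted_tree_imp_tree_on: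
  assumes "rooted_tree V E r p l"
  shows "tree_on V E"
  using assms
proof (induction "card V" arbitrary: V E rule: less_induct)
  case less
  note RD = rooted_treeD[OF less.prems]
  show ?case
  proof (cases "V = {r}")
    case True
    then have "E = {}" using RD(6) by auto
    then show ?thesis using True tree_on.single by metis
  next
    case False
    have ne: "l ` V \<noteq> {}" "finite (l ` V)" using RD(1,2) by auto
    obtain x where x: "x \<in> V" "l x = Max (l ` V)" using Max_in[OF ne(2,1)] by auto
    have mx: "l z \<le> l x" if "z \<in> V" for z using that x(2) ne by simp
    have xr: "x \<noteq> r"
    proof
      assume "x = r"
      obtain z where z: "z \<in> V" "z \<noteq> r" using False RD(2) by blast
      then show False using RD(5)[OF z] mx[OF z(1)] RD(3) \<open>x = r\<close> by simp
    qed
    have npar: "p z \<noteq> x" if "z \<in> V" "z \<noteq> r" for z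
      using mx[OF that(1)] RD(5)[OF that] by auto
    define E' where "E' = E \<inter> (V - {x}) \<times> (V - {x})"
    have "rooted_tree (V - {x}) E' r p l"
      unfolding rooted_tree_def E'_def using RD xr npar by auto
    moreover have "card (V - {x}) < card V" using x(1) RD(1) by (rule card_Diff1_less[rotated])
    ultimately have "tree_on (V - {x}) E'" using less.hyps by blast
    then have "tree_on (insert x (V - {x})) (insert (p x, x) (insert (x, p x) E'))"
      using RD(4)[OF x(1) xr] npar[OF x(1) xr] by (intro tree_on.add_leaf) auto
    moreover have "insert x (V - {x}) = V" using x(1) by auto
    moreover have "insert (p x, x) (insert (x, p x) E') = E"
      (is "?L = E")
    proof (rule set_eqI, clarify)
      fix a b
      show "(a, b) \<in> ?L \<longleftrightarrow> (a, b) \<in> E"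
        unfolding E'_def using x(1) xr RD(4)[OF x(1) xr] npar[of a] npar[of b]
        by (cases "a = x"; cases "b = x"; auto simp: RD(6))
    qed
    ultimately show ?thesis by simp
  qed
qed

lemma rooted_tree_restrict:
  assumes "rooted_tree V E r p l" "W \<subseteq> V" "r \<in> W" "\<And>x. x \<in> W \<Longrightarrow> x \<noteq> r \<Longrightarrow> p x \<in> W"
  shows "rooted_tree W (E \<inter> W \<times> W) r p l"
proof -
  note RD = rooted_treeD[OF assms(1)]
  have "p x \<in> W \<and> l x = Suc (l (p x))" if "x \<in> W - {r}" for x
    using that assms(2,4) RD(5)[of x] by blast
  then show ?thesis
    using RD(1,3) assms(2,3) finite_subset[OF assms(2)] unfolding rooted_tree_def
    by (auto simp: RD(6) subset_iff)
qed

lemma rooted_tree_funpow: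
  assumes "rooted_tree V E r p l" "x \<in> V" "n \<le> l x"
  shows "(p ^^ n) x \<in> V" "l ((p ^^ n) x) = l x - n" "(x, (p ^^ n) x) \<in> E ^^ n"
proof -
  note RD = rooted_treeD[OF assms(1)]
  have "(p ^^ n) x \<in> V \<and> l ((p ^^ n) x) = l x - n \<and> (x, (p ^^ n) x) \<in> E ^^ n"
    using assms(3)
  proof (induction n)
    case 0
    then show ?case using assms(2) by simp
  next
    case (Suc n)
    then have IH: "(p ^^ n) x \<in> V" "l ((p ^^ n) x) = l x - n" "(x, (p ^^ n) x) \<in> E ^^ n" by auto
    with Suc.prems have "(p ^^ n) x \<noteq> r" using RD(3) by auto
    then show ?case using IH RD(4)[OF IH(1)] RD(5)[OF IH(1)] RD(6)
      by (auto intro: relcompI)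
  qed
  then show "(p ^^ n) x \<in> V" "l ((p ^^ n) x) = l x - n" "(x, (p ^^ n) x) \<in> E ^^ n" by auto
qed

lemma rooted_tree_levels_below:
  assumes "rooted_tree V E r p l" "x \<in> V"
  shows "{..l x} \<subseteq> l ` V"
proof
  fix k assume "k \<in> {..l x}"
  then have "l ((p ^^ (l x - k)) x) = k" "(p ^^ (l x - k)) x \<in> V"
    using rooted_tree_funpow[OF assms, of "l x - k"] by auto
  then show "k \<in> l ` V" by force
qed

text \<open>The ancestors of \<open>x\<close> realise all levels from 0 to \<open>l x\<close>, each
  needing its own vertex.\<close>

lemma rooted_tree_level_less_card:
  assumes "rooted_tree V E r p l" "x \<in> V"
  shows "l x < card V"
proof -
  have "card {..l x} \<le> card (l ` V)"
    using rooted_tree_levels_below[OF assms] rooted_treeD(1)[OF assms(1)] by (intro card_mono) auto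
  also have "\<dots> \<le> card V" using rooted_treeD(1)[OF assms(1)] by (rule card_image_le)
  finally show ?thesis by simp
qed

lemma rooted_tree_walk_root:
  assumes "rooted_tree V E r p l" "x \<in> V"
  shows "(x, r) \<in> E ^^ l x"
  using rooted_tree_funpow[OF assms, of "l x"] rooted_tree_level_eq_0[OF assms(1)] by auto

text \<open>Rooting the tree at the target turns the level of \<open>x\<close> into the length of a
  walk.\<close>

lemma tree_on_walk:
  assumes "tree_on V E" "x \<in> V" "y \<in> V"
  shows "\<exists>n < card V. (x, y) \<in> E ^^ n"
proof -
  from tree_on_imp_rooted_tree[OF assms(1,3)] obtain p l where R: "rooted_tree V E y p l" by blast
  show ?thesis
    using rooted_tree_walk_root[OF R assms(2)] rooted_tree_level_less_card[OF R assms(2)] by blast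
qed

section \<open>Subtrees of descendants\<close>

inductive_set desc :: "'a set \<Rightarrow> 'a \<Rightarrow> ('a \<Rightarrow> 'a) \<Rightarrow> 'a \<Rightarrow> 'a set"
  for V r p y where
  self: "y \<in> V \<Longrightarrow> y \<in> desc V r p y"
| child: "\<lbrakk>x \<in> V; x \<noteq> r; p x \<in> desc V r p y\<rbrakk> \<Longrightarrow> x \<in> desc V r p y"

lemma desc_subset: "desc V r p y \<subseteq> V"
  by (auto elim: desc.cases)

context
  fixes V :: "'a set" and E r p l
  assumes R: "rooted_tree V E r p l"
begin

lemma desc_level: "x \<in> desc V r p y \<Longrightarrow> l y \<le> l x"
  by (induction rule: desc.induct) (auto simp: rooted_treeD(5)[OF R])

lemma desc_root: "desc V r p r = V"
proof
  show "V \<subseteq> desc V r p r"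
  proof
    fix x assume "x \<in> V"
    then show "x \<in> desc V r p r"
    proof (induction "l x" arbitrary: x)
      case 0
      then show ?case using rooted_tree_level_eq_0[OF R] by (metis desc.self)
    next
      case (Suc n)
      then have "x \<noteq> r" using rooted_treeD(3)[OF R] by auto
      then show ?case using Suc rooted_treeD(4,5)[OF R Suc.prems] by (metis desc.child nat.inject)
    qed
  qed
qed (rule desc_subset)

lemma rooted_tree_desc:
  assumes "y \<in> V"
  shows "rooted_tree (desc V r p y) (E \<inter> desc V r p y \<times> desc V r p y) y p (\<lambda>x. l x - l y)"
proof -
  have *: "x \<noteq> r \<and> p x \<in> desc V r p y" if "x \<in> desc V r p y" "x \<noteq> y" for x
    using that by (metis desc.cases)
  \<comment> \<open>With \<open>y\<close> as the new root, the pair of \<open>y\<close> and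
    \<open>p y\<close> must not count as an edge inside the subtree; it does not, since
    \<open>p y\<close> has a smaller level and lies outside.\<close>
  have "p y \<notin> desc V r p y" if "y \<noteq> r"
    using desc_level[of "p y" y] rooted_treeD(5)[OF R assms that] by auto
  moreover have "l x - l y = Suc (l (p x) - l y)" if "x \<in> desc V r p y" "x \<noteq> y" for x
    using * [OF that] desc_level[of "p x" y] rooted_treeD(5)[OF R, of x] desc_subset[of V r p y] that by auto
  moreover have "finite (desc V r p y)"
    using desc_subset[of V r p y] rooted_treeD(1)[OF R] by (rule finite_subset)
  moreover have "a \<noteq> y \<and> b = p a \<or> b \<noteq> y \<and> a = p b \<longleftrightarrow> a \<noteq> r \<and> b = p a \<or> b \<noteq> r \<and> a = p b"
    if "a \<in> desc V r p y" "b \<in> desc V r p y" for a b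
    using that * calculation(1) by metis
  ultimately show ?thesis
    using assms desc_subset[of V r p y] * desc.self[of y V r p] unfolding rooted_tree_def
    by (auto simp: rooted_treeD(6)[OF R] subset_iff)
qed

lemma desc_compl_closed:
  assumes "x \<in> V - desc V r p y" "x \<noteq> r"
  shows "p x \<in> V - desc V r p y"
  using assms rooted_treeD(4)[OF R] by (auto intro: desc.child)

lemma desc_child_cover:
  assumes "x \<in> desc V r p y" "x \<noteq> y"
  shows "\<exists>c \<in> V - {r}. p c = y \<and> x \<in> desc V r p c"
  using assms
proof (induction rule: desc.induct)
  case (child x)
  then show ?case by (cases "p x = y") (auto intro: desc.intros)
qed simp

text \<open>Climbing from a common vertex stays in both branches until the top of one of them is
  reached. A top has level 1, and the only vertex of level 1 in the other branch is its own
  top.\<close>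

lemma desc_child_disjoint:
  assumes "x \<in> desc V r p b" "x \<in> desc V r p c" "p b = r" "p c = r" "b \<in> V - {r}" "c \<in> V - {r}"
  shows "b = c"
  using assms
proof (induction rule: desc.induct)
  case self
  show ?case
  proof (rule ccontr)
    assume "b \<noteq> c"
    then have "r \<in> desc V r p c" using self by (metis desc.cases)
    then show False using self desc_level[of r c] rooted_treeD(3)[OF R] rooted_treeD(5)[OF R, of c] by auto
  qed
next
  case (child x)
  have "x \<noteq> c"
  proof
    assume "x = c"
    then show False using child.hyps(3) child.prems desc_level[of r b] rooted_treeD(3)[OF R] rooted_treeD(5)[OF R, of b] by auto
  qed
  then have "p x \<in> desc V r p c" using child.prems(1) by (metis desc.cases)
  then show ?case using child by auto
qed

text \<open>Every edge joins a vertex to its parent, and children of descendants are descendants, so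
  a subtree can only be left upwards from its top vertex.\<close>

lemma desc_edge_cut:
  assumes "(a, b) \<in> E" "a \<in> desc V r p y" "b \<notin> desc V r p y"
  shows "a = y \<and> b = p y \<and> y \<noteq> r"
proof -
  have "a \<noteq> r \<and> b = p a \<or> b \<noteq> r \<and> a = p b" "a \<in> V" "b \<in> V" using assms(1) rooted_treeD(6)[OF R] by auto
  then have "a \<noteq> r" "b = p a" using assms by (auto intro: desc.child)
  moreover have "a = y" using assms(2,3) \<open>b = p a\<close> by (metis desc.cases)
  ultimately show ?thesis by auto
qed

end

section \<open>Trees as pair graphs\<close>

lemma tree_on_pair_graph:
  assumes "tree_on (pverts G) (parcs G)"
  shows "pair_graph G"
proof -
  note T = tree_on_basic[OF assms]
  have "finite (parcs G)" using T(1,3) by (meson finite_SigmaI finite_subset)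
  then show ?thesis
    using T by unfold_locales (auto simp: symmetric_def irrefl_def)
qed

lemma pair_graph_connected_iff:
  assumes "pair_graph G"
  shows "connected (with_proj G) \<longleftrightarrow>
    pverts G \<noteq> {} \<and> (\<forall>u \<in> pverts G. \<forall>v \<in> pverts G. (u, v) \<in> (parcs G)\<^sup>*)"
proof -
  interpret pair_graph G by fact
  \<comment> \<open>Connectedness is defined through the symmetric closure, which here is the graph
    itself.\<close>
  have eq: "mk_symmetric (with_proj G) = G"
    using arcs_symmetric by (auto simp: mk_symmetric_def intro!: pair_pre_digraph.equality)
  have "(u \<rightarrow>\<^sup>*\<^bsub>with_proj G\<^esub> v) \<longleftrightarrow> (u, v) \<in> (parcs G)\<^sup>*" if "u \<in> pverts G" "v \<in> pverts G" for u v
  proof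
    assume "(u, v) \<in> (parcs G)\<^sup>*"
    then show "u \<rightarrow>\<^sup>*\<^bsub>with_proj G\<^esub> v"
      by (induction) (use that(1) in auto)
  qed (use reachable_rtranclI in force)
  then show ?thesis
    unfolding connected_def eq strongly_connected_def by simp
qed

lemma pcas_nth:
  assumes "pcas u p v" "p \<noteq> []"
  shows "fst (p ! 0) = u" "snd (p ! (length p - 1)) = v"
    and "\<And>i. Suc i < length p \<Longrightarrow> snd (p ! i) = fst (p ! Suc i)"
proof -
  have "fst (p ! 0) = u \<and> snd (p ! (length p - 1)) = v \<and>
    (\<forall>i. Suc i < length p \<longrightarrow> snd (p ! i) = fst (p ! Suc i))" (is "?P u p")
    using assms
  proof (induction p arbitrary: u)
    case (Cons e p)
    show ?case
    proof (cases "p = []")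
      case False
      then have "?P (snd e) p" using Cons.prems(1) by (intro Cons.IH) simp_all
      then show ?thesis using Cons.prems False
        by (auto simp: nth_Cons split: nat.splits)
    qed (use Cons in auto)
  qed simp
  then show "fst (p ! 0) = u" "snd (p ! (length p - 1)) = v"
    "\<And>i. Suc i < length p \<Longrightarrow> snd (p ! i) = fst (p ! Suc i)" by auto
qed

lemma pcas_append: "pcas u p v \<Longrightarrow> pcas v q w \<Longrightarrow> pcas u (p @ q) w"
  by (induction p arbitrary: u) auto

lemma tl_pawalk_verts: "pcas u p v \<Longrightarrow> tl (pawalk_verts u p) = map snd p"
proof (induction p arbitrary: u)
  case (Cons e p)
  then have "pawalk_verts (snd e) p = snd e # map snd p"
    by (cases p) auto
  then show ?case by simp
qed simp

text \<open>At a vertex of maximal level on a cycle, both neighbours on the cycle are its parent.\<close>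

lemma tree_on_no_cycle:
  assumes T: "tree_on (pverts G) (parcs G)" and c: "pre_digraph.cycle (with_proj G) c"
  shows "length c < 3"
proof (rule ccontr)
  assume "\<not> length c < 3"
  define n where "n = length c"
  have n: "n \<ge> 3" using \<open>\<not> length c < 3\<close> by (simp add: n_def)
  interpret pair_graph G using tree_on_pair_graph[OF T] .
  from c obtain u where u: "awalk u c u" "distinct (tl (pawalk_verts u c))" "c \<noteq> []"
    by (auto simp: cycle_def)
  from u(1) have cas: "pcas u c u" and sub: "set c \<subseteq> parcs G" by (auto simp: awalk_def)
  have dist: "distinct (map snd c)" using u(2) tl_pawalk_verts[OF cas] by simp
  obtain r where "r \<in> pverts G" using tree_on_basic(2)[OF T] by blast
  from tree_on_imp_rooted_tree[OF T this] obtain p l where R: "rooted_tree (pverts G) (parcs G) r p l"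
    by blast
  \<comment> \<open>Successor of an arc index around the cycle.\<close>
  define s where "s i = (if Suc i < n then Suc i else 0)" for i
  have s: "s i < n" "fst (c ! s i) = snd (c ! i)" if "i < n" for i
    using that pcas_nth[OF cas u(3)] n unfolding s_def n_def by (auto simp: not_less_eq less_Suc_eq)
  have arc: "c ! i \<in> parcs G" if "i < n" for i using sub that by (auto simp: n_def)
  have surj: "\<exists>j < n. s j = i" if "i < n" for i
    using that n by (cases i) (auto simp: s_def intro: exI[of _ "n - 1"])
  obtain i where i: "i < n" "\<And>j. j < n \<Longrightarrow> l (snd (c ! j)) \<le> l (snd (c ! i))"
  proof -
    let ?M = "(\<lambda>j. l (snd (c ! j))) ` {..<n}"
    have "0 \<in> {..<n}" using n by simp
    then have "Max ?M \<in> ?M" by (intro Max_in) blast+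
    then obtain i where "i < n" "Max ?M = l (snd (c ! i))" by auto
    moreover have "l (snd (c ! j)) \<le> Max ?M" if "j < n" for j using that by (intro Max_ge) auto
    ultimately show ?thesis using that by metis
  qed
  obtain j where j: "j < n" "s j = i" using surj i(1) by blast
  have par: "y = p x" if "(x, y) \<in> parcs G" "l y \<le> l x" for x y
    using that rooted_treeD(5)[OF R, of y] rooted_treeD(6)[OF R, of x y] by auto
  have "c ! i = (snd (c ! j), snd (c ! i))" using s(2)[OF j(1)] j(2) by (simp add: prod_eq_iff)
  then have "(snd (c ! i), snd (c ! j)) \<in> parcs G" using arc[OF i(1)] arcs_symmetric by metis
  then have "snd (c ! j) = p (snd (c ! i))" using par i(2)[OF j(1)] by blast
  moreover have "c ! s i = (snd (c ! i), snd (c ! s i))" using s(2)[OF i(1)] by (simp add: prod_eq_iff)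
  then have "(snd (c ! i), snd (c ! s i)) \<in> parcs G" using arc[OF s(1)[OF i(1)]] by metis
  then have "snd (c ! s i) = p (snd (c ! i))" using par i(2)[OF s(1)[OF i(1)]] by blast
  \<comment> \<open>The arcs before and after arc \<open>i\<close> have the same head, the parent of
    the vertex of maximal level. Heads are distinct, so these two arcs coincide, which is impossible
    with at least three arcs.\<close>
  ultimately have "j = s i"
    using dist j(1) s(1)[OF i(1)] by (metis distinct_conv_nth length_map n_def nth_map)
  then show False using j i(1) n unfolding s_def by (auto split: if_splits)
qed

text \<open>In a graph satisfying \<open>is_tree\<close>, a maximal vertex set \<open>W\<close>
  inducing a tree is everything. Otherwise connectedness yields an edge from \<open>W\<close> to
  some \<open>x\<close> outside; a second neighbour of \<open>x\<close> in \<open>W\<close> would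
  close a path inside \<open>W\<close> to a cycle of length at least 3, so \<open>x\<close> is
  attached as a leaf and \<open>W\<close> was not maximal.\<close>

lemma is_tree_iff_tree_on: "is_tree G \<longleftrightarrow> tree_on (pverts G) (parcs G)"
proof
  assume T: "tree_on (pverts G) (parcs G)"
  show "is_tree G"
    unfolding is_tree_def pair_graph_connected_iff[OF tree_on_pair_graph[OF T]]
    using tree_on_pair_graph[OF T] tree_on_basic(2)[OF T] tree_on_no_cycle[OF T]
      tree_on_walk[OF T] relpow_imp_rtrancl
    by (metis not_le)
next
  assume G: "is_tree G"
  then have pg: "pair_graph G" by (simp add: is_tree_def)
  then interpret pair_graph G .
  define V E where "V = pverts G" and "E = parcs G"
  have con: "V \<noteq> {}" "\<And>u v. u \<in> V \<Longrightarrow> v \<in> V \<Longrightarrow> (u, v) \<in> E\<^sup>*"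
    using G pair_graph_connected_iff[OF pg] by (auto simp: is_tree_def V_def E_def)
  have irr: "(x, x) \<notin> E" for x using no_loops' by (auto simp: E_def)
  define P where "P W \<longleftrightarrow> W \<subseteq> V \<and> tree_on W (E \<inter> W \<times> W)" for W
  obtain v where v: "v \<in> V" using con(1) by blast
  have "E \<inter> {v} \<times> {v} = {}" using irr by auto
  then have "P {v}" using v by (simp add: P_def tree_on.single)
  moreover have "\<forall>W. P W \<longrightarrow> card W < Suc (card V)"
    by (auto simp: P_def V_def pair_finite_verts less_Suc_eq_le intro: card_mono)
  ultimately obtain W where W: "P W" "\<And>W'. P W' \<Longrightarrow> card W' \<le> card W"
    using ex_has_greatest_nat[of P "{v}" card "Suc (card V)"] by metis
  have "W = V"
  proof (rule ccontr)
    assume "W \<noteq> V"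
    then obtain z where z: "z \<in> V" "z \<notin> W" using W(1) by (auto simp: P_def)
    obtain w where w: "w \<in> W" using W(1) tree_on_basic(2)[of W "E \<inter> W \<times> W"] by (auto simp: P_def)
    have "(w, z) \<in> E\<^sup>*" using con(2) w z W(1) by (auto simp: P_def)
    then have "\<exists>u x. u \<in> W \<and> x \<notin> W \<and> (u, x) \<in> E"
      using z(2) w by (induction rule: converse_rtrancl_induct) auto
    then obtain u x where ux: "u \<in> W" "x \<notin> W" "(u, x) \<in> E" by blast
    have uniq: "u' = u" if u': "u' \<in> W" "(u', x) \<in> E" for u'
    proof (rule ccontr)
      assume ne: "u' \<noteq> u"
      define H where "H = \<lparr>pverts = W, parcs = E \<inter> W \<times> W\<rparr>"
      have TH: "tree_on (pverts H) (parcs H)" using W(1) by (simp add: H_def P_def)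
      interpret H: pair_graph H using tree_on_pair_graph[OF TH] .
      have "u \<rightarrow>\<^sup>*\<^bsub>with_proj H\<^esub> u'"
      proof -
        obtain n where "(u, u') \<in> parcs H ^^ n"
          using tree_on_walk[OF TH, of u u'] ux u' by (auto simp: H_def)
        then have "(u, u') \<in> (parcs H)\<^sup>*" by (rule relpow_imp_rtrancl)
        have "u \<in> pverts H" using ux by (simp add: H_def)
        from \<open>(u, u') \<in> (parcs H)\<^sup>*\<close> show ?thesis
          by (induction) (use \<open>u \<in> pverts H\<close> in auto)
      qed
      then obtain q where q: "H.apath u q u'" using H.reachable_apath by blast
      have q': "pcas u q u'" "set q \<subseteq> E" "distinct (pawalk_verts u q)" "set q \<subseteq> W \<times> W"
      proof -
        have "pcas u q u'" "distinct (pawalk_verts u q)" "set q \<subseteq> parcs H"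
          using q unfolding H.apath_def H.awalk_def by blast+
        then show "pcas u q u'" "set q \<subseteq> E" "distinct (pawalk_verts u q)" "set q \<subseteq> W \<times> W"
          unfolding H_def by fastforce+
      qed
      have qn: "q \<noteq> []" using q'(1) ne by auto
      define c where "c = q @ [(u', x), (x, u)]"
      have cas: "pcas u c u" unfolding c_def by (rule pcas_append[OF q'(1)]) simp
      have "distinct (map snd q)"
        using q'(1,3) tl_pawalk_verts by (metis distinct_tl)
      moreover have "u \<notin> set (map snd q)"
      proof -
        have "pawalk_verts u q = u # map snd q"
          using tl_pawalk_verts[OF q'(1)] qn q'(1) by (cases q) auto
        then show ?thesis using q'(3) by simp
      qed
      moreover have "x \<notin> set (map snd q)" using q'(4) ux(2) by auto
      ultimately have "distinct (map snd c)" using ux by (auto simp: c_def)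
      moreover have "awalk u c u"
        using cas q'(2) ux u' W(1) arcs_symmetric by (auto simp: awalk_def c_def E_def V_def P_def)
      ultimately have "cycle c" unfolding cycle_def using tl_pawalk_verts[OF cas] by (auto simp: c_def)
      moreover have "length c \<ge> 3" using qn by (cases q) (auto simp: c_def)
      ultimately show False using G by (auto simp: is_tree_def)
    qed
    have sym: "(b, a) \<in> E" if "(a, b) \<in> E" for a b using that arcs_symmetric by (auto simp: E_def)
    have "E \<inter> insert x W \<times> insert x W = insert (u, x) (insert (x, u) (E \<inter> W \<times> W))"
      using ux uniq irr sym by blast
    then have "tree_on (insert x W) (E \<inter> insert x W \<times> insert x W)"
      using W(1) ux tree_on.add_leaf[of W _ u x] by (simp add: P_def)
    moreover have "x \<in> V" using ux(3) in_arcsD2 by (auto simp: E_def V_def)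
    ultimately have "P (insert x W)" using W(1) by (auto simp: P_def)
    moreover have "finite W" using W(1) tree_on_basic(1) by (auto simp: P_def)
    ultimately show False using W(2)[of "insert x W"] ux(2) by simp
  qed
  moreover have "E \<inter> V \<times> V = E" using wellformed' by (auto simp: E_def V_def)
  ultimately show "tree_on (pverts G) (parcs G)" using W(1) by (simp add: P_def V_def E_def)
qed

definition leaf :: "('a \<times> 'a) set \<Rightarrow> 'a \<Rightarrow> bool" where
  "leaf E v \<longleftrightarrow> (\<exists>!w. (v, w) \<in> E)"

lemma leaves_conv: "leaves G = {v \<in> pverts G. leaf (parcs G) v}"
proof -
  have "out_degree (with_proj G) v = 1 \<longleftrightarrow> leaf (parcs G) v" for v
  proof -
    have "out_arcs (with_proj G) v = Pair v ` {w. (v, w) \<in> parcs G}"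
      by (auto simp: out_arcs_def)
    then have "out_degree (with_proj G) v = card {w. (v, w) \<in> parcs G}"
      by (simp add: out_degree_def card_image inj_on_def)
    then show ?thesis by (auto simp: leaf_def card_1_singleton_iff) (metis mem_Collect_eq singletonD singletonI)+
  qed
  then show ?thesis by (auto simp: leaves_def)
qed

text \<open>Walks of length at most \<open>k\<close> replace distances. Members of \<open>D\<close>
  are covered by the walk of length 0, so no case distinction on membership remains.\<close>

definition walk_dominating :: "nat \<Rightarrow> 'a set \<Rightarrow> ('a \<times> 'a) set \<Rightarrow> 'a set \<Rightarrow> bool" where
  "walk_dominating k V E D \<longleftrightarrow> (\<forall>x \<in> V. \<exists>y \<in> D. \<exists>n \<le> k. (x, y) \<in> E ^^ n)"

definition indep_dominating :: "nat \<Rightarrow> 'a set \<Rightarrow> ('a \<times> 'a) set \<Rightarrow> 'a set \<Rightarrow> bool" where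
  "indep_dominating k V E D \<longleftrightarrow> D \<subseteq> V \<and> E \<inter> D \<times> D = {} \<and> walk_dominating k V E D"

section \<open>Distances as walk lengths, isomorphisms as vertex maps\<close>

lemma (in pair_wf_digraph) awalk_iff_relpow:
  assumes "u \<in> pverts G"
  shows "(\<exists>p. awalk u p v \<and> length p = n) \<longleftrightarrow> (u, v) \<in> parcs G ^^ n"
  using assms
proof (induction n arbitrary: u)
  case 0
  then show ?case by (auto simp: awalk_Nil_iff)
next
  case (Suc n)
  show ?case
  proof
    assume "\<exists>p. awalk u p v \<and> length p = Suc n"
    then obtain p where p: "awalk u p v" "length p = Suc n" by blast
    then obtain e q where "p = e # q" by (cases p) auto
    then have "e \<in> parcs G" "fst e = u" "awalk (snd e) q v" "length q = n"
      using p by (auto simp: awalk_Cons_iff)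
    then show "(u, v) \<in> parcs G ^^ Suc n"
      using Suc.IH[of "snd e"] arc_snd_in_verts[of e] by (metis prod.collapse relpow_Suc_I2)
  next
    assume "(u, v) \<in> parcs G ^^ Suc n"
    then obtain w where w: "(u, w) \<in> parcs G" "(w, v) \<in> parcs G ^^ n" by (metis relpow_Suc_E2)
    then obtain q where "awalk w q v" "length q = n" using Suc.IH[of w] in_arcsD2 by blast
    then show "\<exists>p. awalk u p v \<and> length p = Suc n"
      using w(1) by (intro exI[of _ "(u, w) # q"]) (auto simp: awalk_Cons_iff)
  qed
qed

lemma graph_dist_le_iff:
  assumes "pair_wf_digraph G" "u \<in> pverts G"
  shows "graph_dist G u v \<le> ereal (real d) \<longleftrightarrow> (\<exists>n \<le> d. (u, v) \<in> parcs G ^^ n)"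
proof -
  interpret pair_wf_digraph G by fact
  have cost: "awalk_cost (\<lambda>_. 1) p = real (length p)" for p :: "('a \<times> 'a) list"
    by (induction p) (auto simp: awalk_cost_def)
  have mu: "graph_dist G u v = (INF p\<in>{p. awalk u p v}. ereal (real (length p)))"
    by (simp add: graph_dist_def \<mu>_def cost)
  show ?thesis
  proof
    assume le: "graph_dist G u v \<le> ereal (real d)"
    \<comment> \<open>An infimum yields a walk only from a strict bound; lengths are integers, so
      \<open>Suc d\<close> loses nothing.\<close>
    then have "(INF p\<in>{p. awalk u p v}. ereal (real (length p))) < ereal (real (Suc d))"
      unfolding mu by (rule order_le_less_trans) simp
    then obtain p where "awalk u p v" "length p < Suc d" by (auto simp: INF_less_iff)
    then show "\<exists>n \<le> d. (u, v) \<in> parcs G ^^ n"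
      using awalk_iff_relpow[OF assms(2)] by (metis less_Suc_eq_le)
  next
    assume "\<exists>n \<le> d. (u, v) \<in> parcs G ^^ n"
    then obtain p where "awalk u p v" "length p \<le> d"
      using awalk_iff_relpow[OF assms(2)] by metis
    then show "graph_dist G u v \<le> ereal (real d)"
      unfolding mu by (intro INF_lower2[of p]) auto
  qed
qed

lemma indep_dist_dominating_iff:
  assumes "pair_wf_digraph G"
  shows "independent_set G S \<and> dist_dominating d G S \<longleftrightarrow> indep_dominating d (pverts G) (parcs G) S"
proof -
  have "(v \<in> pverts G - S \<longrightarrow> (\<exists>u\<in>S. graph_dist G v u \<le> ereal (real d))) \<longleftrightarrow>
      (v \<in> pverts G \<longrightarrow> (\<exists>y\<in>S. \<exists>n\<le>d. (v, y) \<in> parcs G ^^ n))" for v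
  proof (cases "v \<in> S")
    case True
    then show ?thesis by (auto intro!: bexI[of _ v] exI[of _ 0])
  qed (auto simp: graph_dist_le_iff[OF assms])
  then show ?thesis
    unfolding independent_set_def dist_dominating_def indep_dominating_def walk_dominating_def by blast
qed

text \<open>An arc of a pair graph is the pair of its ends, so an isomorphism, which also carries
  maps for arcs, tails and heads, is determined by its vertex map \<open>f\<close>.\<close>

lemma digraph_iso_with_proj_iff:
  assumes "pair_wf_digraph G"
  shows "digraph_iso (with_proj G) (with_proj H) \<longleftrightarrow>
    (\<exists>f. inj_on f (pverts G) \<and> pverts H = f ` pverts G \<and> parcs H = map_prod f f ` parcs G)"
proof
  interpret pair_wf_digraph G by fact
  assume "digraph_iso (with_proj G) (with_proj H)"
  then obtain h where h: "digraph_isomorphism h" "with_proj H = app_iso h (with_proj G)"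
    by (auto simp: digraph_iso_def)
  define f where "f = iso_verts h"
  have "fst = iso_tail h" "snd = iso_head h" "parcs H = iso_arcs h ` parcs G" "pverts H = f ` pverts G"
    using arg_cong[OF h(2), of tail] arg_cong[OF h(2), of head] arg_cong[OF h(2), of arcs]
      arg_cong[OF h(2), of verts]
    by (auto simp: app_iso_def f_def)
  moreover have "iso_arcs h e = map_prod f f e" if "e \<in> parcs G" for e
    using h(1) that \<open>fst = iso_tail h\<close>[symmetric] \<open>snd = iso_head h\<close>[symmetric]
    by (auto simp: digraph_isomorphism_def f_def map_prod_def prod_eq_iff split: prod.splits)
  ultimately show "\<exists>f. inj_on f (pverts G) \<and> pverts H = f ` pverts G \<and> parcs H = map_prod f f ` parcs G"
    using h(1) by (intro exI[of _ f]) (auto simp: digraph_isomorphism_def f_def)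
next
  interpret pair_wf_digraph G by fact
  assume "\<exists>f. inj_on f (pverts G) \<and> pverts H = f ` pverts G \<and> parcs H = map_prod f f ` parcs G"
  then obtain f where f: "inj_on f (pverts G)" "pverts H = f ` pverts G" "parcs H = map_prod f f ` parcs G"
    by blast
  have "inj_on (map_prod f f) (parcs G)"
  proof (rule inj_onI)
    fix a b assume "a \<in> parcs G" "b \<in> parcs G" "map_prod f f a = map_prod f f b"
    then show "a = b"
      using inj_onD[OF f(1), of "fst a" "fst b"] inj_onD[OF f(1), of "snd a" "snd b"]
        arc_fst_in_verts[of a] arc_snd_in_verts[of a] arc_fst_in_verts[of b] arc_snd_in_verts[of b]
      by (cases a; cases b) simp
  qed
  then have "digraph_isomorphism \<lparr>iso_verts = f, iso_arcs = map_prod f f, iso_head = snd, iso_tail = fst\<rparr>"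
    using f(1) wf_digraph by (auto simp: digraph_isomorphism_def)
  then show "digraph_iso (with_proj G) (with_proj H)"
    unfolding digraph_iso_def
    by (intro exI conjI, assumption) (auto simp: app_iso_def f with_proj_def)
qed

section \<open>Independent dominating sets of bounded size\<close>

lemma relpow_mono:
  fixes E F :: "('a \<times> 'a) set"
  shows "E \<subseteq> F \<Longrightarrow> (x, y) \<in> E ^^ n \<Longrightarrow> (x, y) \<in> F ^^ n"
  by (induction n arbitrary: y) auto

lemma walk_dominating_mono:
  assumes "walk_dominating k V E D" "E \<subseteq> F" "k \<le> m" "D \<subseteq> D'"
  shows "walk_dominating m V F D'"
  unfolding walk_dominating_def
proof
  fix x assume "x \<in> V"
  then obtain y n where "y \<in> D" "n \<le> k" "(x, y) \<in> E ^^ n" using assms(1) by (auto simp: walk_dominating_def)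
  then show "\<exists>y\<in>D'. \<exists>n\<le>m. (x, y) \<in> F ^^ n" using assms(2-) relpow_mono[OF assms(2)] by (meson order_trans subsetD)
qed

lemma walk_dominating_Un:
  "walk_dominating k V E D \<Longrightarrow> walk_dominating k W E D \<Longrightarrow> walk_dominating k (V \<union> W) E D"
  by (auto simp: walk_dominating_def)

definition level_class :: "'a set \<Rightarrow> ('a \<Rightarrow> nat) \<Rightarrow> nat \<Rightarrow> nat \<Rightarrow> 'a set" where
  "level_class V l d i = {x \<in> V. l x mod d = i}"

lemma mod_neq_Suc: "2 \<le> d \<Longrightarrow> a mod d \<noteq> Suc a mod d" for a d :: nat
  by (metis One_nat_def Suc_1 Suc_n_not_le_n mod_Suc n_not_Suc_n nat.simps(3) numeral_2_eq_2)

lemma level_class_indep: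
  assumes "rooted_tree V E r p l" "2 \<le> d"
  shows "E \<inter> level_class V l d i \<times> level_class V l d i = {}"
proof -
  have "l a mod d \<noteq> l b mod d" if "(a, b) \<in> E" for a b
    using rooted_tree_adj_level[OF assms(1) that] mod_neq_Suc[OF assms(2)] by metis
  then show ?thesis by (auto simp: level_class_def) metis
qed

lemma level_class_reach:
  assumes "rooted_tree V E r p l" "x \<in> V" "i < d" "i \<le> l x"
  shows "\<exists>y \<in> level_class V l d i. \<exists>n \<le> d - 1. (x, y) \<in> E ^^ n"
proof -
  \<comment> \<open>The number of steps up to the nearest ancestor of class \<open>i\<close>; it is
    at most \<open>l x - i\<close>, so the root is not overshot.\<close>
  define n where "n = (l x - i) mod d"
  have "n < d" using assms(3) unfolding n_def by (intro mod_less_divisor) simp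
  then have n: "n \<le> d - 1" "n \<le> l x - i" by (auto simp: n_def)
  have "(l x - i - n) mod d = 0" unfolding n_def using minus_mod_eq_mult_div by (metis mod_mult_self1_is_0)
  then have "(i + (l x - i - n)) mod d = i" using assms(3) by (metis add.right_neutral mod_add_right_eq mod_less)
  moreover have "i + (l x - i - n) = l x - n" using n assms(4) by simp
  ultimately have "(p ^^ n) x \<in> level_class V l d i"
    using rooted_tree_funpow[OF assms(1,2), of n] n assms(4) by (simp add: level_class_def)
  moreover have "(x, (p ^^ n) x) \<in> E ^^ n"
    using rooted_tree_funpow[OF assms(1,2), of n] n by simp
  ultimately show ?thesis using n(1) by blast
qed

lemma card_level_classes:
  assumes "finite V" "0 < d"
  shows "(\<Sum>i<d. card (level_class V l d i)) = card V"
proof -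
  have "V = (\<Union>i<d. level_class V l d i)" using assms(2) by (auto simp: level_class_def)
  then have "card V = card (\<Union>i<d. level_class V l d i)" by simp
  also have "\<dots> = (\<Sum>i<d. card (level_class V l d i))"
    using assms(1) by (intro card_UN_disjoint) (auto simp: level_class_def)
  finally show ?thesis by simp
qed

section \<open>Trees cut at one edge, and the upper bound\<close>

definition edge_join ::
  "'a set \<Rightarrow> ('a \<times> 'a) set \<Rightarrow> 'a set \<Rightarrow> 'a set \<Rightarrow> 'a \<Rightarrow> 'a \<Rightarrow> bool" where
  "edge_join V E R S u y \<longleftrightarrow> V = R \<union> S \<and> R \<inter> S = {} \<and> u \<in> R \<and> y \<in> S \<and>
     tree_on R (E \<inter> R \<times> R) \<and> tree_on S (E \<inter> S \<times> S) \<and>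
     E = E \<inter> R \<times> R \<union> E \<inter> S \<times> S \<union> {(u, y), (y, u)}"

lemma edge_joinD:
  assumes "edge_join V E R S u y"
  shows "V = R \<union> S" "R \<inter> S = {}" "u \<in> R" "y \<in> S"
    "tree_on R (E \<inter> R \<times> R)" "tree_on S (E \<inter> S \<times> S)" "(u, y) \<in> E" "(y, u) \<in> E"
    "\<And>a b. (a, b) \<in> E \<Longrightarrow> a \<in> R \<Longrightarrow> b \<in> S \<Longrightarrow> a = u \<and> b = y"
    "\<And>a b. (a, b) \<in> E \<Longrightarrow> a \<in> S \<Longrightarrow> b \<in> R \<Longrightarrow> a = y \<and> b = u"
    "sym E" "E \<subseteq> V \<times> V" "finite R" "finite S" "card V = card R + card S"
proof -
  have J: "V = R \<union> S" "R \<inter> S = {}" "u \<in> R" "y \<in> S"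
      "tree_on R (E \<inter> R \<times> R)" "tree_on S (E \<inter> S \<times> S)"
    and eq: "E = E \<inter> R \<times> R \<union> E \<inter> S \<times> S \<union> {(u, y), (y, u)}"
    using assms unfolding edge_join_def by blast+
  note J = J equalityD1[OF eq] equalityD2[OF eq]
  show "V = R \<union> S" "R \<inter> S = {}" "u \<in> R" "y \<in> S"
    "tree_on R (E \<inter> R \<times> R)" "tree_on S (E \<inter> S \<times> S)" "(u, y) \<in> E" "(y, u) \<in> E" using J by blast+
  show "a = u \<and> b = y" if "(a, b) \<in> E" "a \<in> R" "b \<in> S" for a b using J that by blast
  show "a = y \<and> b = u" if "(a, b) \<in> E" "a \<in> S" "b \<in> R" for a b using J that by blast
  show "sym E"
  proof (rule symI)
    fix a b assume "(a, b) \<in> E"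
    then show "(b, a) \<in> E"
      using J tree_on_symD[of R _ a b] tree_on_symD[of S _ a b] by blast
  qed
  show "E \<subseteq> V \<times> V" using J by blast
  show fin: "finite R" "finite S" using J tree_on_basic(1) by blast+
  show "card V = card R + card S" using J fin by (simp add: card_Un_disjoint)
qed

text \<open>Here \<open>m\<close> and \<open>n\<close> are the orders of \<open>R\<close> and
  \<open>S\<close>, \<open>b\<close> is the size of class 0 of \<open>R\<close>, \<open>a\<close>
  the smallest size of another class, and \<open>c\<close> counts the children of \<open>y\<close>
  with deep subtrees. If a \<le> b, then d a \<le> m and d \<le> n, and the first candidate works.
  Otherwise a = b + e, and with k = d - 1 failure of the second candidate makes c at least k e + 1,
  while failure of the first bounds c k by k + e; together k^2 e \<le> e, impossible for k \<ge>
  2.\<close>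

lemma candidate_count:
  fixes a b c d m n :: nat
  assumes d: "2 \<le> d" and m: "b + (d - 1) * a \<le> m" and n: "Suc (c * (d - 1)) \<le> n" "d \<le> n"
  shows "d * Suc a \<le> m + n \<and> (3 \<le> d \<and> d * Suc a = m + n \<longrightarrow> n = d) \<or>
    d * (b + c) \<le> m + n \<and> (3 \<le> d \<and> d * (b + c) = m + n \<longrightarrow> n = d)"
proof -
  obtain k where k: "d = Suc k" "1 \<le> k" using d by (cases d) auto
  show ?thesis
  proof (cases "a \<le> b")
    case True
    then have "d * a \<le> m" using m k by simp
    then show ?thesis using n(2) by auto
  next
    case False
    then obtain e where e: "a = b + e" "1 \<le> e" by (metis less_imp_add_positive not_le Suc_leI One_nat_def)
    have mn: "b + k * b + k * e + Suc (c * k) \<le> m + n" using m n(1) k e by (simp add: algebra_simps)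
    show ?thesis
    proof (rule ccontr)
      assume neg: "\<not> ?thesis"
      \<comment> \<open>For k \<ge> 2 a candidate also fails when it meets the bound exactly with n
        \<noteq> d, so only weak inequalities are available; for k = 1 they are strict.\<close>
      have A: "m + n \<le> d * Suc a" "k = 1 \<Longrightarrow> m + n < d * Suc a"
        and B: "m + n \<le> d * (b + c)" "k = 1 \<Longrightarrow> m + n < d * (b + c)"
        using neg k by auto
      have B1: "k * e + 1 \<le> c" using mn B(1) k by (simp add: algebra_simps)
      have A1: "c * k \<le> k + e" using mn A(1) k e by (simp add: algebra_simps)
      show False
      proof (cases "k = 1")
        case True
        then show False using mn A(2) B(2) k e by (simp add: algebra_simps)
      next
        case False
        then have "2 \<le> k" using k by simp
        have "(k * e + 1) * k \<le> c * k" using B1 by (rule mult_right_mono) simp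
        moreover have "(k * e + 1) * k = k * k * e + k" by (simp add: algebra_simps)
        ultimately have "k * k * e \<le> e" using A1 by linarith
        moreover have "4 * e \<le> k * k * e" using \<open>2 \<le> k\<close> mult_mono[of 2 k 2 k] by (intro mult_right_mono) auto
        ultimately show False using e(2) by simp
      qed
    qed
  qed
qed

text \<open>
  In the next lemma \<open>R\<close> is levelled from \<open>u\<close>, so its level class 0 contains \<open>u\<close> and every other
  class is compatible with \<open>y\<close>. One candidate set is \<open>y\<close> together with the smallest class other
  than class 0; the other one is class 0 together with those children of \<open>y\<close> whose subtrees reach
  depth \<open>d - 1\<close> below \<open>y\<close>.
\<close>

lemma edge_join_indep_dominating:
  assumes J: "edge_join V E R S u y" and d: "2 \<le> d"
    and RS: "rooted_tree S (E \<inter> S \<times> S) y p l" and deep: "\<And>x. x \<in> S \<Longrightarrow> l x \<le> d - 1"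
    and cS: "d \<le> card S"
  shows "\<exists>D. indep_dominating (d - 1) V E D \<and> d * card D \<le> card V \<and>
    (3 \<le> d \<and> d * card D = card V \<longrightarrow> card S = d)"
proof -
  note JD = edge_joinD[OF J]
  from tree_on_imp_rooted_tree[OF JD(5,3)] obtain q m where RR: "rooted_tree R (E \<inter> R \<times> R) u q m"
    by blast
  define X where "X = level_class R m d"
  have XR: "X i \<subseteq> R" for i by (auto simp: X_def level_class_def)
  have finX: "finite (X i)" for i using XR JD(13) finite_subset by blast
  obtain i where i: "i \<in> {1..<d}" "\<And>j. j \<in> {1..<d} \<Longrightarrow> card (X i) \<le> card (X j)"
  proof -
    have "{1..<d} \<noteq> {}" using d by auto
    then obtain i where "i \<in> {1..<d}" "card (X i) = Min ((\<lambda>j. card (X j)) ` {1..<d})"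
      using Min_in[of "(\<lambda>j. card (X j)) ` {1..<d}"] by fastforce
    then show ?thesis using that by (metis Min_le finite_atLeastLessThan finite_imageI imageI)
  qed
  have sumR: "card R = card (X 0) + (\<Sum>j\<in>{1..<d}. card (X j))"
  proof -
    have "card R = (\<Sum>j\<in>{..<d}. card (X j))"
      using card_level_classes[of R d m] JD(13) d by (simp add: X_def)
    also have "{..<d} = insert 0 {1..<d}" using d by auto
    finally show ?thesis by simp
  qed
  have R_ge: "card (X 0) + (d - 1) * card (X i) \<le> card R"
    unfolding sumR using sum_mono[of "{1..<d}" "\<lambda>_. card (X i)" "\<lambda>j. card (X j)"] i(2) by simp
  have XindepE: "E \<inter> X j \<times> X j = {}" for j
    using level_class_indep[OF RR d, of j] XR[of j] by (auto simp: X_def)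
  have reachX: "\<exists>z \<in> X j. \<exists>n \<le> d - 1. (x, z) \<in> E ^^ n" if "x \<in> R" "j < d" "j \<le> m x" for x j
    using level_class_reach[OF RR that] relpow_mono[of "E \<inter> R \<times> R" E] unfolding X_def by blast
  have u0: "u \<in> X 0" using rooted_treeD(2,3)[OF RR] by (simp add: X_def level_class_def)
  have to_y: "(x, y) \<in> E ^^ l x" if "x \<in> S" for x
    using rooted_tree_walk_root[OF RS that] relpow_mono[of "E \<inter> S \<times> S" E] by blast
  have to_u: "(x, u) \<in> E ^^ m x" if "x \<in> R" for x
    using rooted_tree_walk_root[OF RR that] relpow_mono[of "E \<inter> R \<times> R" E] by blast
  define A where "A = insert y (X i)"
  have "indep_dominating (d - 1) V E A"
    unfolding indep_dominating_def
  proof (intro conjI)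
    show "A \<subseteq> V" using XR[of i] JD(1,4) by (auto simp: A_def)
    have "u \<notin> X i" using rooted_treeD(3)[OF RR] i(1) by (auto simp: X_def level_class_def)
    moreover have "(y, y) \<notin> E" using tree_on_basic(5)[OF JD(6)] JD(4) by (auto simp: irrefl_def)
    ultimately show "E \<inter> A \<times> A = {}"
      using XindepE[of i] JD(9,10) XR[of i] JD(4) unfolding A_def by blast
    show "walk_dominating (d - 1) V E A"
      unfolding walk_dominating_def
    proof
      fix x assume "x \<in> V"
      consider "x \<in> S" | "x \<in> R" "i \<le> m x" | "x \<in> R" "m x < i" using \<open>x \<in> V\<close> JD(1) by force
      then show "\<exists>z\<in>A. \<exists>n\<le>d - 1. (x, z) \<in> E ^^ n"
      proof cases
        case 1
        then show ?thesis using to_y deep unfolding A_def by blast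
      next
        case 2
        then show ?thesis using reachX i(1) unfolding A_def by fastforce
      next
        case 3
        \<comment> \<open>No ancestor of \<open>x\<close> is in class \<open>i\<close>, so
          \<open>x\<close> leaves \<open>R\<close> through \<open>u\<close>: \<open>m x\<close>
          steps up and one across to \<open>y\<close>, at most \<open>i\<close> in total.\<close>
        then have "Suc (m x) \<le> d - 1" using i(1) by auto
        moreover have "(x, y) \<in> E ^^ Suc (m x)" using to_u[OF 3(1)] JD(7) by auto
        ultimately show ?thesis unfolding A_def by blast
      qed
    qed
  qed
  moreover have "card A = Suc (card (X i))"
    using finX XR JD(2,4) unfolding A_def by (subst card_insert_disjoint) auto
  moreover
  \<comment> \<open>Going up d - 2 levels from the vertices of depth d - 1 in \<open>S\<close> ends
    at level 1, at those children of \<open>y\<close> that have a descendant of this depth. For d =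
    2 the starting vertices themselves are taken.\<close>
  define C where "C = (p ^^ (d - 2)) ` {x \<in> S. l x = d - 1}"
  have CS: "c \<in> S" "l c = 1" if c: "c \<in> C" for c
    using rooted_tree_funpow[OF RS, of _ "d - 2"] c d by (auto simp: C_def)
  have finC: "finite C" using JD(14) by (auto simp: C_def)
  define B where "B = X 0 \<union> C"
  have "indep_dominating (d - 1) V E B"
    unfolding indep_dominating_def
  proof (intro conjI)
    show "B \<subseteq> V" using XR[of 0] CS(1) JD(1) by (auto simp: B_def)
    have yC: "y \<notin> C" using CS(2) rooted_treeD(3)[OF RS] by force
    have "(a, b) \<notin> E" if "a \<in> C" "b \<in> C" for a b
      using rooted_tree_adj_level[OF RS, of a b] CS[OF that(1)] CS[OF that(2)] by auto
    then show "E \<inter> B \<times> B = {}"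
      using XindepE[of 0] JD(9,10) XR[of 0] CS(1) yC unfolding B_def by blast
    show "walk_dominating (d - 1) V E B"
      unfolding walk_dominating_def
    proof
      fix x assume "x \<in> V"
      consider "x \<in> R" | "x \<in> S" "l x = d - 1" | "x \<in> S" "l x < d - 1"
        using \<open>x \<in> V\<close> JD(1) deep[of x] by force
      then show "\<exists>z\<in>B. \<exists>n\<le>d - 1. (x, z) \<in> E ^^ n"
      proof cases
        case 1
        then show ?thesis using reachX[of x 0] d unfolding B_def by fastforce
      next
        case 2
        then have "(x, (p ^^ (d - 2)) x) \<in> E ^^ (d - 2)" "(p ^^ (d - 2)) x \<in> C"
          using rooted_tree_funpow(3)[OF RS 2(1), of "d - 2"] relpow_mono[of "E \<inter> S \<times> S" E]
          by (auto simp: C_def)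
        moreover have "d - 2 \<le> d - 1" by simp
        ultimately show ?thesis unfolding B_def by blast
      next
        case 3
        \<comment> \<open>Depth below d - 1 leaves room for the extra step from \<open>y\<close> to
          \<open>u\<close>, which belongs to class 0.\<close>
        then have "Suc (l x) \<le> d - 1" by simp
        moreover have "(x, u) \<in> E ^^ Suc (l x)" using to_y[OF 3(1)] JD(8) by auto
        ultimately show ?thesis using u0 unfolding B_def by blast
      qed
    qed
  qed
  moreover have "card B = card (X 0) + card C"
    unfolding B_def using finX finC XR CS JD(2) by (intro card_Un_disjoint) blast+
  \<comment> \<open>Each \<open>c\<close> in \<open>C\<close> has a path of d - 1 vertices down to
    some \<open>x c\<close> of depth d - 1. A vertex \<open>g (c, j)\<close> on it determines
    \<open>j\<close> by its level and \<open>c\<close> as its ancestor of level 1, so these paths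
    are disjoint, and \<open>y\<close> is on none of them.\<close>
  moreover have "Suc (card C * (d - 1)) \<le> card S"
  proof -
    have "\<forall>c\<in>C. \<exists>x. x \<in> S \<and> l x = d - 1 \<and> (p ^^ (d - 2)) x = c" by (auto simp: C_def)
    then obtain x where x: "\<And>c. c \<in> C \<Longrightarrow> x c \<in> S \<and> l (x c) = d - 1 \<and> (p ^^ (d - 2)) (x c) = c"
      by metis
    define g where "g = (\<lambda>(c, j). (p ^^ j) (x c))"
    have g: "g (c, j) \<in> S" "l (g (c, j)) = d - 1 - j" "(p ^^ (d - 2 - j)) (g (c, j)) = c"
      if "c \<in> C" "j < d - 1" for c j
    proof -
      show "g (c, j) \<in> S" "l (g (c, j)) = d - 1 - j"
        using rooted_tree_funpow[OF RS, of "x c" j] x[OF that(1)] that(2) by (auto simp: g_def)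
      have "(p ^^ (d - 2 - j)) (g (c, j)) = (p ^^ (d - 2 - j + j)) (x c)"
        by (simp add: g_def funpow_add)
      also have "d - 2 - j + j = d - 2" using that(2) by simp
      finally show "(p ^^ (d - 2 - j)) (g (c, j)) = c" using x[OF that(1)] by simp
    qed
    have "inj_on g (C \<times> {..<d - 1})"
    proof (rule inj_onI, clarify)
      fix a i b j assume H: "a \<in> C" "b \<in> C" "i < d - 1" "j < d - 1" "g (a, i) = g (b, j)"
      then have "i = j" using g(2)[OF H(1,3)] g(2)[OF H(2,4)] H(3-5) by simp
      then show "a = b \<and> i = j" using g(3)[OF H(1,3)] g(3)[OF H(2,4)] H(5) by metis
    qed
    moreover have "g ` (C \<times> {..<d - 1}) \<subseteq> S - {y}"
    proof (clarify)
      fix c j assume H: "c \<in> C" "j < d - 1"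
      then have "l (g (c, j)) \<noteq> 0" using g(2)[of c j] by simp
      then show "g (c, j) \<in> S - {y}" using g(1)[OF H] rooted_treeD(3)[OF RS] by (metis DiffI singletonD)
    qed
    ultimately have "card (C \<times> {..<d - 1}) \<le> card (S - {y})"
      by (rule card_inj_on_le) (simp add: JD(14))
    moreover have "card S = Suc (card (S - {y}))" using card_Suc_Diff1[OF JD(14,4)] by simp
    ultimately show ?thesis by (simp add: card_cartesian_product)
  qed
  ultimately show ?thesis
    using candidate_count[OF d R_ge _ cS, of "card C"] JD(15) by metis
qed

lemma tree_indep_dominating:
  assumes T: "tree_on V E" and d: "2 \<le> d" "d \<le> card V"
  shows "\<exists>D. indep_dominating (d - 1) V E D \<and> d * card D \<le> card V \<and>
    (3 \<le> d \<and> d * card D = card V \<longrightarrow>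
      card V = d \<or> (\<exists>R S u y. edge_join V E R S u y \<and> card S = d))"
proof -
  obtain r where "r \<in> V" using tree_on_basic(2)[OF T] by blast
  from tree_on_imp_rooted_tree[OF T this] obtain p l where R: "rooted_tree V E r p l" by blast
  note RD = rooted_treeD[OF R]
  define Q where "Q = {y \<in> V. d \<le> card (desc V r p y)}"
  have "r \<in> Q" using RD(2) d desc_root[OF R] by (simp add: Q_def)
  moreover have finQ: "finite (l ` Q)" using RD(1) by (simp add: Q_def)
  ultimately have "Max (l ` Q) \<in> l ` Q" by (intro Max_in) auto
  then obtain y where y: "y \<in> Q" "l y = Max (l ` Q)" by force
  define S where "S = desc V r p y"
  have yV: "y \<in> V" "d \<le> card S" using y(1) by (auto simp: Q_def S_def)
  have RS: "rooted_tree S (E \<inter> S \<times> S) y p (\<lambda>x. l x - l y)"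
    using rooted_tree_desc[OF R yV(1)] by (simp add: S_def)
  \<comment> \<open>By maximality of its level, \<open>y\<close> has no child in \<open>Q\<close>.
    The subtree of a child therefore has at most d - 1 vertices and reaches at most d - 2 levels
    below that child.\<close>
  have deep: "l x - l y \<le> d - 1" if xS: "x \<in> S" for x
  proof (cases "x = y")
    case False
    then obtain c where c: "c \<in> V - {r}" "p c = y" "x \<in> desc V r p c"
      using desc_child_cover[OF R xS[unfolded S_def] False] by blast
    have lc: "l c = Suc (l y)" using RD(5)[of c] c by auto
    then have "c \<notin> Q" using y(2) Max_ge[OF finQ imageI[of c Q l]] by auto
    then have "card (desc V r p c) < d" using c(1) by (simp add: Q_def)
    moreover have "l x - l c < card (desc V r p c)"
      using rooted_tree_level_less_card[OF rooted_tree_desc[OF R] c(3)] c(1) by simp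
    ultimately have "l x - l c < d - 1" by simp
    then show ?thesis using lc by simp
  qed simp
  show ?thesis
  proof (cases "y = r")
    case True
    then have "S = V" using desc_root[OF R] by (simp add: S_def)
    have "walk_dominating (d - 1) V E {y}"
      unfolding walk_dominating_def using deep rooted_tree_walk_root[OF R] \<open>S = V\<close> True RD(3) by fastforce
    moreover have "(y, y) \<notin> E" using tree_on_basic(5)[OF T] by (auto simp: irrefl_def)
    ultimately have "indep_dominating (d - 1) V E {y}" using yV(1) by (auto simp: indep_dominating_def)
    then show ?thesis using d by (intro exI[of _ "{y}"]) auto
  next
    case False
    define W where "W = V - S"
    have SV: "S \<subseteq> V" unfolding S_def by (rule desc_subset)
    have "r \<notin> S" using desc_level[OF R, of r y] RD(3) RD(5)[OF yV(1) False] by (auto simp: S_def)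
    then have RW: "rooted_tree W (E \<inter> W \<times> W) r p l"
      using desc_compl_closed[OF R] RD(2) by (intro rooted_tree_restrict[OF R]) (auto simp: W_def S_def)
    have "y \<in> S" using yV(1) by (simp add: S_def desc.self)
    have "p y \<in> W"
      using desc_level[OF R, of "p y" y] RD(4,5)[OF yV(1) False] by (auto simp: W_def S_def)
    have "edge_join V E W S (p y) y"
      unfolding edge_join_def
    proof (intro conjI)
      show "tree_on W (E \<inter> W \<times> W)" "tree_on S (E \<inter> S \<times> S)"
        using RW RS by (auto intro: rooted_tree_imp_tree_on)
      have cut: "a = y \<and> b = p y" if "(a, b) \<in> E" "a \<in> S" "b \<notin> S" for a b
        using desc_edge_cut[OF R] that unfolding S_def by blast
      have "(y, p y) \<in> E" "(p y, y) \<in> E" using RD(4,6) yV(1) False by auto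
      have "e \<in> E \<inter> W \<times> W \<union> E \<inter> S \<times> S \<union> {(p y, y), (y, p y)}" if e: "e \<in> E" for e
      proof (cases e)
        case (Pair a b)
        have "a \<in> V" "b \<in> V" "(b, a) \<in> E"
          using e Pair tree_on_basic(3)[OF T] tree_on_symD[OF T] by auto
        then show ?thesis using e Pair cut[of a b] cut[of b a] unfolding W_def by blast
      qed
      then show "E = E \<inter> W \<times> W \<union> E \<inter> S \<times> S \<union> {(p y, y), (y, p y)}"
        using \<open>(y, p y) \<in> E\<close> \<open>(p y, y) \<in> E\<close> by blast
    qed (use SV \<open>y \<in> S\<close> \<open>p y \<in> W\<close> in \<open>auto simp: W_def\<close>)
    then show ?thesis
      using edge_join_indep_dominating[OF _ d(1) RS deep yV(2)] by blast
  qed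
qed

section \<open>The extremal trees for \<open>d \<ge> 3\<close>\<close>

abbreviation corona_arcs :: "'a set \<Rightarrow> ('a \<times> 'a) set \<Rightarrow> nat \<Rightarrow> (('a \<times> nat) \<times> ('a \<times> nat)) set" where
  "corona_arcs W F k \<equiv> parcs (attach_paths \<lparr>pverts = W, parcs = F\<rparr> k)"

definition path_corona ::
  "nat \<Rightarrow> 'b set \<Rightarrow> ('b \<times> 'b) set \<Rightarrow> 'a set \<Rightarrow> ('a \<times> 'a) set \<Rightarrow> ('a \<times> nat \<Rightarrow> 'b) \<Rightarrow> bool" where
  "path_corona k V E W F f \<longleftrightarrow> tree_on W F \<and> inj_on f (W \<times> {0..k}) \<and> V = f ` (W \<times> {0..k}) \<and>
     E = map_prod f f ` corona_arcs W F k"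

lemma corona_arcs_iff:
  "((a, i), (b, j)) \<in> corona_arcs W F k \<longleftrightarrow>
     i = 0 \<and> j = 0 \<and> (a, b) \<in> F \<or> a = b \<and> a \<in> W \<and> i \<le> k \<and> j \<le> k \<and> (j = Suc i \<or> i = Suc j)"
  by (auto simp: attach_paths_def)

lemma corona_arcs_subset:
  "F \<subseteq> W \<times> W \<Longrightarrow> corona_arcs W F k \<subseteq> (W \<times> {0..k}) \<times> (W \<times> {0..k})"
  by (auto simp: attach_paths_def)

lemma path_corona_arc_iff:
  assumes C: "path_corona k V E W F f" and "a \<in> W" "b \<in> W" "i \<le> k" "j \<le> k"
  shows "(f (a, i), f (b, j)) \<in> E \<longleftrightarrow>
    i = 0 \<and> j = 0 \<and> (a, b) \<in> F \<or> a = b \<and> (j = Suc i \<or> i = Suc j)"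
proof -
  have inj: "inj_on f (W \<times> {0..k})" and E: "E = map_prod f f ` corona_arcs W F k"
    and F: "F \<subseteq> W \<times> W"
    using C tree_on_basic(3) by (auto simp: path_corona_def)
  have "(f (a, i), f (b, j)) \<in> E \<longleftrightarrow> ((a, i), (b, j)) \<in> corona_arcs W F k"
  proof
    assume "(f (a, i), f (b, j)) \<in> E"
    then obtain p q where pq: "(p, q) \<in> corona_arcs W F k" "f (a, i) = f p" "f (b, j) = f q"
      unfolding E by auto
    then have "p \<in> W \<times> {0..k}" "q \<in> W \<times> {0..k}" using corona_arcs_subset[OF F, of k] by auto
    then have "p = (a, i)" "q = (b, j)" using inj_onD[OF inj pq(2)] inj_onD[OF inj pq(3)] assms by auto
    then show "((a, i), (b, j)) \<in> corona_arcs W F k" using pq(1) by simp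
  qed (auto simp: E intro!: rev_image_eqI)
  then show ?thesis using assms by (auto simp: corona_arcs_iff)
qed

lemma path_corona_walk:
  assumes C: "path_corona k V E W F f" and w: "w \<in> W" and ij: "i \<le> j" "j \<le> k"
  shows "(f (w, i), f (w, j)) \<in> E ^^ (j - i)" "(f (w, j), f (w, i)) \<in> E ^^ (j - i)"
proof -
  have "(f (w, i), f (w, j)) \<in> E ^^ (j - i) \<and> (f (w, j), f (w, i)) \<in> E ^^ (j - i)"
    using ij
  proof (induction j rule: dec_induct)
    case (step n)
    have "(f (w, n), f (w, Suc n)) \<in> E" "(f (w, Suc n), f (w, n)) \<in> E"
      using path_corona_arc_iff[OF C w w] step.prems by auto
    moreover have "Suc n - i = Suc (n - i)" using step.hyps by simp
    ultimately show ?case using step by (auto intro: relpow_Suc_I2 simp del: relpow.simps(2)) (auto)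
  qed simp
  then show "(f (w, i), f (w, j)) \<in> E ^^ (j - i)" "(f (w, j), f (w, i)) \<in> E ^^ (j - i)" by auto
qed

lemma path_corona_card:
  assumes "path_corona k V E W F f"
  shows "card V = Suc k * card W" "finite W" "finite V"
proof -
  have "inj_on f (W \<times> {0..k})" "V = f ` (W \<times> {0..k})" "tree_on W F"
    using assms by (auto simp: path_corona_def)
  then show "card V = Suc k * card W" "finite W" "finite V"
    using tree_on_basic(1) by (auto simp: card_image card_cartesian_product)
qed

definition end_path :: "nat \<Rightarrow> 'a set \<Rightarrow> ('a \<times> 'a) set \<Rightarrow> (nat \<Rightarrow> 'a) \<Rightarrow> bool" where
  "end_path k S E g \<longleftrightarrow> bij_betw g {0..k} S \<and>
     E = {(g i, g j) | i j. i \<le> k \<and> j \<le> k \<and> (j = Suc i \<or> i = Suc j)}"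

text \<open>A vertex of depth k needs all levels from 0 to k on its way to the root
  \<open>y\<close>. With k + 1 vertices every level then occurs exactly once, and the tree is a path
  starting at \<open>y\<close>. Otherwise all depths are below k.\<close>

lemma tree_end_path_or_close:
  assumes T: "tree_on S E" and y: "y \<in> S" and k: "card S = Suc k"
  shows "(\<exists>g. end_path k S E g \<and> g 0 = y) \<or> (\<forall>x \<in> S. \<exists>n < k. (x, y) \<in> E ^^ n)"
proof -
  from tree_on_imp_rooted_tree[OF T y] obtain p l where R: "rooted_tree S E y p l" by blast
  note RD = rooted_treeD[OF R]
  show ?thesis
  proof (cases "\<forall>x \<in> S. l x < k")
    case True
    then show ?thesis using rooted_tree_walk_root[OF R] by blast
  next
    case False
    then obtain x where x: "x \<in> S" "l x = k"
      using rooted_tree_level_less_card[OF R] k by (metis less_antisym)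
    have "l ` S \<subseteq> {0..k}" using rooted_tree_level_less_card[OF R] k by (auto simp: less_Suc_eq_le)
    moreover have "{0..k} \<subseteq> l ` S" using rooted_tree_levels_below[OF R x(1)] x(2) by (auto simp: atMost_def subset_iff)
    ultimately have img: "l ` S = {0..k}" by simp
    then have inj: "inj_on l S" using RD(1) k by (intro eq_card_imp_inj_on) auto
    define g where "g = inv_into S l"
    have g: "bij_betw g {0..k} S" unfolding g_def using img inj by (metis bij_betw_def bij_betw_inv_into)
    have lg: "l (g i) = i" "g i \<in> S" if "i \<le> k" for i
      using that img unfolding g_def by (auto intro: f_inv_into_f inv_into_into)
    have gl: "g (l z) = z" if "z \<in> S" for z using that inj by (simp add: g_def)
    have adj: "(a, b) \<in> E \<longleftrightarrow> l a = Suc (l b) \<or> l b = Suc (l a)" if "a \<in> S" "b \<in> S" for a b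
    proof
      assume "l a = Suc (l b) \<or> l b = Suc (l a)"
      then show "(a, b) \<in> E"
      proof
        assume H: "l a = Suc (l b)"
        then have "a \<noteq> y" using RD(3) by auto
        then have "p a = b" using RD(4,5)[OF that(1)] H that(2) inj by (auto dest: inj_onD)
        then show ?thesis using RD(6) that \<open>a \<noteq> y\<close> by auto
      next
        assume H: "l b = Suc (l a)"
        then have "b \<noteq> y" using RD(3) by auto
        then have "p b = a" using RD(4,5)[OF that(2)] H that(1) inj by (auto dest: inj_onD)
        then show ?thesis using RD(6) that \<open>b \<noteq> y\<close> by auto
      qed
    qed (rule rooted_tree_adj_level[OF R])
    have "E = {(g i, g j) | i j. i \<le> k \<and> j \<le> k \<and> (j = Suc i \<or> i = Suc j)}" (is "E = ?P")
    proof
      show "E \<subseteq> ?P"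
      proof
        fix e assume e: "e \<in> E"
        obtain a b where ab: "e = (a, b)" by (cases e)
        have S: "a \<in> S" "b \<in> S" using e ab RD(6) by auto
        have "l a \<le> k" "l b \<le> k" using S img by auto
        moreover have "l b = Suc (l a) \<or> l a = Suc (l b)" using adj[OF S] e ab by auto
        moreover have "e = (g (l a), g (l b))" using ab gl S by simp
        ultimately show "e \<in> ?P" by blast
      qed
      show "?P \<subseteq> E" using adj lg by auto
    qed
    moreover have "g 0 = y" using gl[OF y] RD(3) by simp
    ultimately show ?thesis using g by (auto simp: end_path_def)
  qed
qed

text \<open>The normalisation \<open>f (w, 0) = w\<close> places \<open>W\<close> inside
  \<open>R\<close>. So \<open>y\<close>, which lies in \<open>S\<close>, is a fresh index and can
  serve as the base vertex of its own path.\<close>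

lemma path_corona_extend:
  assumes J: "edge_join V E R S u y" and C: "path_corona k R (E \<inter> R \<times> R) W F f"
    and id: "\<And>w. w \<in> W \<Longrightarrow> f (w, 0) = w" and u: "u \<in> W"
    and g: "end_path k S (E \<inter> S \<times> S) g" "g 0 = y"
  shows "path_corona k V E (insert y W) (insert (u, y) (insert (y, u) F))
    (\<lambda>(w, i). if w = y then g i else f (w, i))"
proof -
  note JD = edge_joinD[OF J]
  have T: "tree_on W F" and inj: "inj_on f (W \<times> {0..k})" and R: "R = f ` (W \<times> {0..k})"
    and ER: "E \<inter> R \<times> R = map_prod f f ` corona_arcs W F k"
    using C by (auto simp: path_corona_def)
  have gS: "g ` {0..k} = S" "inj_on g {0..k}" using g(1) by (auto simp: end_path_def bij_betw_def)
  have WR: "W \<subseteq> R" using id unfolding R by force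
  then have yW: "y \<notin> W" using JD(2,4) by blast
  define h where "h = (\<lambda>(w, i). if w = y then g i else f (w, i))"
  have hW: "h q = f q" if "q \<in> W \<times> {0..k}" for q using that yW by (auto simp: h_def)
  have hy: "h (y, i) = g i" for i by (simp add: h_def)
  have F: "F \<subseteq> W \<times> W" using tree_on_basic(3)[OF T] .
  have dom: "insert y W \<times> {0..k} = W \<times> {0..k} \<union> {y} \<times> {0..k}" by auto
  have img: "h ` (W \<times> {0..k}) = R" unfolding R using hW by (intro image_cong) auto
  have img2: "h ` ({y} \<times> {0..k}) = S" using gS(1) hy by force
  have "inj_on h (insert y W \<times> {0..k})"
    unfolding dom
  proof (rule inj_on_Un[THEN iffD2], intro conjI)
    show "inj_on h (W \<times> {0..k})" using inj hW by (auto simp: inj_on_def)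
    show "inj_on h ({y} \<times> {0..k})" using gS(2) by (auto simp: inj_on_def hy)
    show "h ` (W \<times> {0..k} - {y} \<times> {0..k}) \<inter> h ` ({y} \<times> {0..k} - W \<times> {0..k}) = {}"
      using img img2 JD(2) by blast
  qed
  moreover have "V = h ` (insert y W \<times> {0..k})" unfolding dom image_Un img img2 by (rule JD(1))
  moreover have "E = map_prod h h ` corona_arcs (insert y W) (insert (u, y) (insert (y, u) F)) k"
  proof -
    have e1: "corona_arcs (insert y W) (insert (u, y) (insert (y, u) F)) k =
      corona_arcs W F k \<union> {((y, i), (y, j)) | i j. i \<le> k \<and> j \<le> k \<and> (j = Suc i \<or> i = Suc j)} \<union>
      {((u, 0), (y, 0)), ((y, 0), (u, 0))}" (is "_ = _ \<union> ?Y \<union> ?Z")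
      by (auto simp: attach_paths_def)
    have e2: "map_prod h h ` corona_arcs W F k = map_prod f f ` corona_arcs W F k"
      using corona_arcs_subset[OF F, of k] hW by (intro image_cong) (auto simp: map_prod_def)
    have e3: "map_prod h h ` ?Y = E \<inter> S \<times> S"
    proof -
      have "map_prod h h ` ?Y = {(h (y, i), h (y, j)) | i j. i \<le> k \<and> j \<le> k \<and> (j = Suc i \<or> i = Suc j)}"
        (is "_ = ?M")
      proof
        show "?M \<subseteq> map_prod h h ` ?Y"
        proof
          fix e assume "e \<in> ?M"
          then obtain i j where ij: "e = map_prod h h ((y, i), (y, j))" "((y, i), (y, j)) \<in> ?Y" by auto
          then show "e \<in> map_prod h h ` ?Y" by (rule image_eqI)
        qed
        show "map_prod h h ` ?Y \<subseteq> ?M"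
        proof
          fix e assume "e \<in> map_prod h h ` ?Y"
          then obtain i j where "e = (h (y, i), h (y, j))" "i \<le> k" "j \<le> k" "j = Suc i \<or> i = Suc j"
            by (elim imageE CollectE exE conjE) simp
          then show "e \<in> ?M" by blast
        qed
      qed
      then show ?thesis using g(1) by (simp only: end_path_def hy)
    qed
    have e4: "map_prod h h ` ?Z = {(u, y), (y, u)}"
      using hW[of "(u, 0)"] u id[OF u] hy g(2) by auto
    have e5: "E = E \<inter> R \<times> R \<union> E \<inter> S \<times> S \<union> {(u, y), (y, u)}"
      using J unfolding edge_join_def by blast
    show ?thesis unfolding e1 image_Un e2 e3 e4 ER[symmetric] by (rule e5)
  qed
  moreover have "tree_on (insert y W) (insert (u, y) (insert (y, u) F))"
    using tree_on.add_leaf[OF T u yW] by simp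
  ultimately show ?thesis unfolding path_corona_def h_def by blast
qed

lemma edge_join_sym: "edge_join V E R S u y \<Longrightarrow> edge_join V E S R y u"
  unfolding edge_join_def by blast

lemma tree_on_neighbour:
  assumes "tree_on V E" "2 \<le> card V" "v \<in> V"
  shows "\<exists>w. (v, w) \<in> E"
proof -
  have "\<exists>z \<in> V. z \<noteq> v"
    using assms(2,3) tree_on_basic(1)[OF assms(1)] by (metis card_2_iff' card_le_Suc0_iff_eq le_trans not_less_eq_eq numeral_2_eq_2)
  then obtain z where "z \<in> V" "z \<noteq> v" by blast
  then obtain n where "(v, z) \<in> E ^^ n" "n \<noteq> 0" using tree_on_walk[OF assms(1,3)] by (metis relpow_0_E)
  then show ?thesis by (metis not0_implies_Suc relpow_Suc_E2)
qed

text \<open>A set for \<open>R\<close> extends to \<open>V\<close> by any one vertex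
  \<open>s\<close> of \<open>S\<close> other than \<open>y\<close>: it has no neighbour in
  \<open>R\<close>, and all of \<open>S\<close> is within k of it because \<open>S\<close> has only
  k + 1 vertices.\<close>

lemma tight_edge_join:
  assumes J: "edge_join V E R S u y" and S: "card S = Suc k" "1 \<le> k"
    and tight: "\<And>D. indep_dominating k V E D \<Longrightarrow> card V \<le> Suc k * card D"
    and D: "indep_dominating k R (E \<inter> R \<times> R) D"
  shows "card R \<le> Suc k * card D"
proof -
  note JD = edge_joinD[OF J]
  obtain s where s: "s \<in> S" "s \<noteq> y"
  proof -
    have "S \<noteq> {y}" using S by auto
    then show ?thesis using that JD(4) by blast
  qed
  have DR: "D \<subseteq> R" "(E \<inter> R \<times> R) \<inter> D \<times> D = {}" "walk_dominating k R (E \<inter> R \<times> R) D"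
    using D by (auto simp: indep_dominating_def)
  have "indep_dominating k V E (insert s D)"
    unfolding indep_dominating_def
  proof (intro conjI)
    show "insert s D \<subseteq> V" using s DR(1) JD(1) by auto
    have "(s, s) \<notin> E" using tree_on_basic(5)[OF JD(6)] s by (auto simp: irrefl_def)
    then show "E \<inter> insert s D \<times> insert s D = {}" using DR s JD(9,10) by blast
    have "walk_dominating k S E {s}"
      unfolding walk_dominating_def
    proof
      fix x assume "x \<in> S"
      then obtain n where "n < Suc k" "(x, s) \<in> (E \<inter> S \<times> S) ^^ n"
        using tree_on_walk[OF JD(6) _ s(1)] S by auto
      then show "\<exists>z\<in>{s}. \<exists>n\<le>k. (x, z) \<in> E ^^ n"
        using relpow_mono[of "E \<inter> S \<times> S" E] by (auto simp: less_Suc_eq_le)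
    qed
    then have "walk_dominating k S E (insert s D)" by (rule walk_dominating_mono) auto
    moreover have "walk_dominating k R E (insert s D)" using DR(3) by (rule walk_dominating_mono) auto
    ultimately show "walk_dominating k V E (insert s D)" unfolding JD(1) by (intro walk_dominating_Un)
  qed
  then have "card V \<le> Suc k * card (insert s D)" by (rule tight)
  also have "card (insert s D) = Suc (card D)"
    using s DR(1) JD(2,13) finite_subset[OF DR(1)] by (subst card_insert_disjoint) auto
  finally show ?thesis using JD(15) S by simp
qed

text \<open>Tightness demands at least \<open>card W\<close> + 1 elements, as many as there are
  paths in \<open>R\<close> plus one for \<open>S\<close>. If \<open>u\<close> is not the foot of
  its path, or \<open>S\<close> is not a path starting at \<open>y\<close>, a set with only
  \<open>card W\<close> elements is exhibited.\<close>

lemma path_corona_join_tight: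
  assumes J: "edge_join V E R S u y" and S: "card S = Suc k" and k: "1 \<le> k"
    and tight: "\<And>D. indep_dominating k V E D \<Longrightarrow> card V \<le> Suc k * card D"
    and C: "path_corona k R (E \<inter> R \<times> R) W F f" and W: "2 \<le> card W"
    and id: "\<And>w. w \<in> W \<Longrightarrow> f (w, 0) = w"
  shows "u \<in> W \<and> (\<exists>g. end_path k S (E \<inter> S \<times> S) g \<and> g 0 = y)"
proof -
  note JD = edge_joinD[OF J]
  have T: "tree_on W F" and inj: "inj_on f (W \<times> {0..k})" and R: "R = f ` (W \<times> {0..k})"
    using C by (auto simp: path_corona_def)
  have fR: "f (w, i) \<in> R" if "w \<in> W" "i \<le> k" for w i using that unfolding R by auto
  have cV: "card V = Suc k * card W + Suc k" using JD(15) S path_corona_card(1)[OF C] by simp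
  have big: False if "indep_dominating k V E D" "card D \<le> card W" for D
  proof -
    have "Suc k * card D \<le> Suc k * card W" using that(2) by (rule mult_left_mono) simp
    then show False using tight[OF that(1)] cV by linarith
  qed
  note arc = path_corona_arc_iff[OF C]
  have arcE: "(f (a, i), f (b, j)) \<in> E \<longleftrightarrow>
    i = 0 \<and> j = 0 \<and> (a, b) \<in> F \<or> a = b \<and> (j = Suc i \<or> i = Suc j)"
    if "a \<in> W" "b \<in> W" "i \<le> k" "j \<le> k" for a b i j
    using arc[OF that] fR that by auto
  have walk: "(f (w, i), f (w, j)) \<in> E ^^ (j - i)" "(f (w, j), f (w, i)) \<in> E ^^ (j - i)"
    if "w \<in> W" "i \<le> j" "j \<le> k" for w i j
    using path_corona_walk[OF C that] relpow_mono[of "E \<inter> R \<times> R" E] by auto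
  have irrF: "(a, a) \<notin> F" for a using tree_on_basic(5)[OF T] by (auto simp: irrefl_def)
  have near: "\<exists>n \<le> k. (f (w, i), f (w, j)) \<in> E ^^ n" if "w \<in> W" "i \<le> k" "j \<le> k" for w i j
  proof (cases "i \<le> j")
    case True
    have "j - i \<le> k" using that by simp
    then show ?thesis using walk(1)[OF that(1) True that(3)] by blast
  next
    case False
    have "i - j \<le> k" using that by simp
    moreover have "j \<le> i" using False by simp
    ultimately show ?thesis using walk(2)[OF that(1) _ that(2)] by blast
  qed
  \<comment> \<open>Inside \<open>R\<close> the vertex \<open>f (w, 1)\<close> is adjacent only to
    vertices of its own path, so taking it rather than the foot avoids conflicts between different
    paths.\<close>
  have others: "walk_dominating k (f ` ((W - X) \<times> {0..k})) E ((\<lambda>w. f (w, 1)) ` (W - X))" for X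
    unfolding walk_dominating_def using near k by fastforce
  obtain v j where v: "v \<in> W" "j \<le> k" "u = f (v, j)" using JD(3) unfolding R by auto
  have "j = 0"
  proof (rule ccontr)
    assume "j \<noteq> 0"
    obtain v' where v': "(v, v') \<in> F" using tree_on_neighbour[OF T W v(1)] by blast
    have vv: "v' \<in> W" "v' \<noteq> v" using v' tree_on_basic(3)[OF T] irrF by auto
    define Q where "Q = (\<lambda>w. f (w, 1)) ` (W - {v, v'})"
    \<comment> \<open>The path of \<open>v\<close> gets no vertex of its own. Its vertices of index
      below k reach the foot and then \<open>f (v', 0)\<close> within k steps; the far end reaches
      \<open>u\<close> and then \<open>y\<close> in k - j + 1 \<le> k steps because j \<ge> 1. As
      \<open>u\<close> is not selected, \<open>y\<close> has no neighbour in
      \<open>D\<close>.\<close>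
    define D where "D = insert (f (v', 0)) (insert y Q)"
    have QR: "Q \<subseteq> R" using fR k by (auto simp: Q_def)
    have "indep_dominating k V E D"
      unfolding indep_dominating_def
    proof (intro conjI)
      show "D \<subseteq> V" using QR fR vv JD(1,4) by (auto simp: D_def)
      have "u \<notin> Q"
        using v k by (auto simp: Q_def dest!: inj_onD[OF inj])
      moreover have "u \<noteq> f (v', 0)" using v vv by (auto dest!: inj_onD[OF inj])
      moreover have "(y, y) \<notin> E" using tree_on_basic(5)[OF JD(6)] JD(4) by (auto simp: irrefl_def)
      ultimately have "(y, b) \<notin> E \<and> (b, y) \<notin> E" if "b \<in> D" for b
        using that JD(9,10) JD(4) QR fR[OF vv(1), of 0] unfolding D_def by blast
      moreover have "(a, b) \<notin> E" if "a \<in> insert (f (v', 0)) Q" "b \<in> insert (f (v', 0)) Q" for a b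
        using that k vv irrF by (auto simp: Q_def arcE)
      ultimately show "E \<inter> D \<times> D = {}" unfolding D_def by blast
      have "walk_dominating k S E D"
        unfolding walk_dominating_def
      proof
        fix x assume "x \<in> S"
        then obtain n where "n < Suc k" "(x, y) \<in> (E \<inter> S \<times> S) ^^ n"
          using tree_on_walk[OF JD(6) _ JD(4)] S by auto
        then show "\<exists>z\<in>D. \<exists>n\<le>k. (x, z) \<in> E ^^ n"
          using relpow_mono[of "E \<inter> S \<times> S" E] unfolding D_def by (auto simp: less_Suc_eq_le)
      qed
      moreover have "walk_dominating k (f ` ((W - {v, v'}) \<times> {0..k})) E D"
        using others by (rule walk_dominating_mono) (auto simp: D_def Q_def)
      moreover have "walk_dominating k (f ` ({v'} \<times> {0..k})) E D"
        unfolding walk_dominating_def D_def using near[OF vv(1)] by fastforce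
      moreover have "walk_dominating k (f ` ({v} \<times> {0..k})) E D"
        unfolding walk_dominating_def
      proof clarify
        fix i assume "i \<in> {0..k}"
        then consider "i < k" | "i = k" by force
        then show "\<exists>z\<in>D. \<exists>n\<le>k. (f (v, i), z) \<in> E ^^ n"
        proof cases
          case 1
          then have "(f (v, i), f (v, 0)) \<in> E ^^ i" using walk(2)[OF v(1), of 0 i] by simp
          moreover have "(f (v, 0), f (v', 0)) \<in> E" using v' v(1) vv(1) by (simp add: arcE)
          ultimately have "(f (v, i), f (v', 0)) \<in> E ^^ Suc i" by auto
          then show ?thesis using 1 unfolding D_def by (meson Suc_leI insertI1)
        next
          case 2
          then have "(f (v, i), u) \<in> E ^^ (k - j)" using walk(2)[OF v(1), of j k] v by simp
          then have "(f (v, i), y) \<in> E ^^ Suc (k - j)" using JD(7) by auto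
          moreover have "Suc (k - j) \<le> k" using \<open>j \<noteq> 0\<close> v(2) by simp
          ultimately show ?thesis unfolding D_def by blast
        qed
      qed
      moreover have "V = S \<union> (f ` ((W - {v, v'}) \<times> {0..k}) \<union> (f ` ({v'} \<times> {0..k}) \<union> f ` ({v} \<times> {0..k})))"
      proof -
        have "W \<times> {0..k} = (W - {v, v'}) \<times> {0..k} \<union> ({v'} \<times> {0..k} \<union> {v} \<times> {0..k})"
          using v(1) vv(1) by auto
        then show ?thesis using JD(1) R by (metis image_Un sup_commute)
      qed
      ultimately show "walk_dominating k V E D" by (simp add: walk_dominating_Un)
    qed
    moreover have "card D \<le> card W"
    proof -
      have "card Q \<le> card (W - {v, v'})"
        unfolding Q_def using path_corona_card(2)[OF C] by (intro card_image_le) auto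
      also have "\<dots> = card W - 2"
        using v(1) vv path_corona_card(2)[OF C] by (subst card_Diff_subset) auto
      finally have "card Q + 2 \<le> card W" using W by simp
      moreover have "card D \<le> card Q + 2"
        unfolding D_def using finite_subset[OF QR JD(13)] by (simp add: card_insert_if)
      ultimately show ?thesis by simp
    qed
    ultimately show False by (rule big)
  qed
  then have uW: "u \<in> W" "u = f (u, 0)" "v = u" using v id by auto
  moreover have "\<exists>g. end_path k S (E \<inter> S \<times> S) g \<and> g 0 = y"
  proof (rule ccontr)
    assume "\<nexists>g. end_path k S (E \<inter> S \<times> S) g \<and> g 0 = y"
    then have close: "\<forall>x \<in> S. \<exists>n < k. (x, y) \<in> (E \<inter> S \<times> S) ^^ n"
      using tree_end_path_or_close[OF JD(6,4) S] by blast
    define Q where "Q = (\<lambda>w. f (w, 1)) ` (W - {u})"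
    \<comment> \<open>All of \<open>S\<close> is within k - 1 of \<open>y\<close>, hence within k of
      \<open>u\<close>, so \<open>u\<close> serves both its own path and \<open>S\<close>.\<close>
    define D where "D = insert (f (u, 0)) Q"
    have QR: "Q \<subseteq> R" using fR k by (auto simp: Q_def)
    have "indep_dominating k V E D"
      unfolding indep_dominating_def
    proof (intro conjI)
      show "D \<subseteq> V" using QR uW(2) JD(1,3) by (auto simp: D_def)
      show "E \<inter> D \<times> D = {}"
        using k uW(1) irrF by (auto simp: D_def Q_def arcE)
      have "walk_dominating k S E D"
        unfolding walk_dominating_def
      proof
        fix x assume "x \<in> S"
        then obtain n where n: "n < k" "(x, y) \<in> (E \<inter> S \<times> S) ^^ n" using close by blast
        then have "(x, u) \<in> E ^^ Suc n" using relpow_mono[of "E \<inter> S \<times> S" E] JD(8) by auto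
        then show "\<exists>z\<in>D. \<exists>n\<le>k. (x, z) \<in> E ^^ n" using n(1) uW(2) unfolding D_def by (metis Suc_leI insertI1)
      qed
      moreover have "walk_dominating k (f ` ((W - {u}) \<times> {0..k})) E D"
        using others by (rule walk_dominating_mono) (auto simp: D_def Q_def)
      moreover have "walk_dominating k (f ` ({u} \<times> {0..k})) E D"
        unfolding walk_dominating_def D_def using near[OF uW(1)] by fastforce
      moreover have "V = S \<union> (f ` ((W - {u}) \<times> {0..k}) \<union> f ` ({u} \<times> {0..k}))"
      proof -
        have "W \<times> {0..k} = (W - {u}) \<times> {0..k} \<union> {u} \<times> {0..k}"
          using uW(1) by auto
        then show ?thesis using JD(1) R by (metis image_Un sup_commute)
      qed
      ultimately show "walk_dominating k V E D" by (simp add: walk_dominating_Un)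
    qed
    moreover have "card D \<le> card W"
    proof -
      have "card Q \<le> card (W - {u})"
        unfolding Q_def using path_corona_card(2)[OF C] by (intro card_image_le) auto
      also have "\<dots> = card W - 1" using uW(1) by simp
      finally show ?thesis unfolding D_def using W by (intro card_insert_le_m1) auto
    qed
    ultimately show False by (rule big)
  qed
  ultimately show ?thesis by blast
qed

lemma tight_imp_path_corona:
  assumes "tree_on V E" "2 \<le> k" "Suc k \<le> card V"
    and "\<And>D. indep_dominating k V E D \<Longrightarrow> card V \<le> Suc k * card D"
  shows "card V = Suc k \<or>
    (\<exists>W F f. path_corona k V E W F f \<and> 2 \<le> card W \<and> (\<forall>w \<in> W. f (w, 0) = w))"
  using assms(1,3,4)
proof (induction "card V" arbitrary: V E rule: less_induct)
  case less
  have k: "1 \<le> k" using assms(2) by simp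
  obtain D where D: "indep_dominating k V E D" "Suc k * card D \<le> card V"
    "3 \<le> Suc k \<and> Suc k * card D = card V \<longrightarrow>
      card V = Suc k \<or> (\<exists>R S u y. edge_join V E R S u y \<and> card S = Suc k)"
    using tree_indep_dominating[OF less.prems(1) _ less.prems(2)] assms(2)
    by (metis Suc_1 Suc_leI diff_Suc_1 k le_imp_less_Suc)
  then have eq: "Suc k * card D = card V" using less.prems(3) by (simp add: le_antisym)
  show ?case
  proof (cases "card V = Suc k")
    case False
    then obtain R S u y where J: "edge_join V E R S u y" and S: "card S = Suc k"
      using D(3) eq assms(2) by auto
    note JD = edge_joinD[OF J]
    have tight_R: "card R \<le> Suc k * card D" if "indep_dominating k R (E \<inter> R \<times> R) D" for D
      using tight_edge_join[OF J S k less.prems(3) that] .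
    \<comment> \<open>Tightness together with the upper bound makes \<open>card V\<close> a multiple
      of k + 1, so \<open>card R\<close> is one too; being nonempty, \<open>R\<close> is large
      enough for the induction hypothesis.\<close>
    have "Suc k dvd card R" using eq JD(15) S by (metis dvd_add_left_iff dvd_refl dvd_triv_left)
    moreover have "card R \<noteq> 0" using JD(3,13) by auto
    ultimately have cR: "Suc k \<le> card R" by (auto dest: dvd_imp_le)
    have "card R < card V" using JD(15) S by simp
    from less.hyps[OF this JD(5) cR tight_R]
    consider "card R = Suc k"
      | W F f where "path_corona k R (E \<inter> R \<times> R) W F f" "2 \<le> card W" "\<forall>w \<in> W. f (w, 0) = w"
      by blast
    then have "\<exists>W F f. path_corona k V E W F f \<and> 2 \<le> card W \<and> (\<forall>w \<in> W. f (w, 0) = w)"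
    proof cases
      case 1
      \<comment> \<open>With both sides of order k + 1, each is a path starting at its end of the
        joining edge: if \<open>B\<close> were not, \<open>a\<close> alone would dominate both
        sides. The claim is stated for arbitrary \<open>A\<close> and \<open>B\<close> so that it
        applies to either side.\<close>
      have path: "\<exists>g. end_path k B (E \<inter> B \<times> B) g \<and> g 0 = b"
        if J': "edge_join V E A B a b" and card: "card A = Suc k" "card B = Suc k" for A B a b
      proof (rule ccontr)
        note J'D = edge_joinD[OF J']
        assume "\<nexists>g. end_path k B (E \<inter> B \<times> B) g \<and> g 0 = b"
        then have close: "\<forall>x \<in> B. \<exists>n < k. (x, b) \<in> (E \<inter> B \<times> B) ^^ n"
          using tree_end_path_or_close[OF J'D(6,4) card(2)] by blast
        have "walk_dominating k A E {a}"
          unfolding walk_dominating_def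
        proof
          fix x assume "x \<in> A"
          then obtain n where "n < Suc k" "(x, a) \<in> (E \<inter> A \<times> A) ^^ n"
            using tree_on_walk[OF J'D(5) _ J'D(3)] card by auto
          then show "\<exists>z\<in>{a}. \<exists>n\<le>k. (x, z) \<in> E ^^ n"
            using relpow_mono[of "E \<inter> A \<times> A" E] by (auto simp: less_Suc_eq_le)
        qed
        moreover have "walk_dominating k B E {a}"
          unfolding walk_dominating_def
        proof
          fix x assume "x \<in> B"
          then obtain n where n: "n < k" "(x, b) \<in> (E \<inter> B \<times> B) ^^ n" using close by blast
          then have "(x, a) \<in> E ^^ Suc n" using relpow_mono[of "E \<inter> B \<times> B" E] J'D(8) by auto
          then show "\<exists>z\<in>{a}. \<exists>n\<le>k. (x, z) \<in> E ^^ n" using n(1) by (metis Suc_leI singletonI)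
        qed
        moreover have "(a, a) \<notin> E" using tree_on_basic(5)[OF J'D(5)] J'D(3) by (auto simp: irrefl_def)
        ultimately have "indep_dominating k V E {a}"
          using J'D(1,3) by (auto simp: indep_dominating_def intro: walk_dominating_Un)
        then show False using less.prems(3)[of "{a}"] False J'D(15) card by simp
      qed
      obtain g where g: "end_path k S (E \<inter> S \<times> S) g" "g 0 = y" using path[OF J 1 S] by blast
      obtain h where h: "end_path k R (E \<inter> R \<times> R) h" "h 0 = u"
        using path[OF edge_join_sym[OF J] S 1] by blast
      have "path_corona k R (E \<inter> R \<times> R) {u} {} (\<lambda>(w, i). h i)"
        unfolding path_corona_def
      proof (intro conjI)
        show "inj_on (\<lambda>(w, i). h i) ({u} \<times> {0..k})" "R = (\<lambda>(w, i). h i) ` ({u} \<times> {0..k})"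
          using h(1) by (auto simp: end_path_def bij_betw_def inj_on_def)
        show "E \<inter> R \<times> R = map_prod (\<lambda>(w, i). h i) (\<lambda>(w, i). h i) ` corona_arcs {u} {} k"
          using h(1) by (auto simp: end_path_def attach_paths_def intro!: rev_image_eqI)
      qed (rule tree_on.single)
      from path_corona_extend[OF J this _ _ g] h(2)
      have "path_corona k V E {y, u} {(u, y), (y, u)} (\<lambda>(w, i). if w = y then g i else case (w, i) of (w, i) \<Rightarrow> h i)"
        by simp
      moreover have "u \<noteq> y" using JD(2,3,4) by blast
      ultimately show ?thesis using g(2) h(2)
        by (intro exI[of _ "{y, u}"] exI[of _ "{(u, y), (y, u)}"] exI conjI) auto
    next
      case (2 W F f)
      obtain g where u: "u \<in> W" and g: "end_path k S (E \<inter> S \<times> S) g" "g 0 = y"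
        using path_corona_join_tight[OF J S k less.prems(3) 2(1,2)] 2(3) by blast
      have "path_corona k V E (insert y W) (insert (u, y) (insert (y, u) F))
          (\<lambda>(w, i). if w = y then g i else f (w, i))"
        using path_corona_extend[OF J 2(1) _ u g] 2(3) by blast
      moreover have "2 \<le> card (insert y W)"
        using 2(2) path_corona_card(2)[OF 2(1)] by (simp add: card_insert_if)
      moreover have "\<forall>w \<in> insert y W. (\<lambda>(w, i). if w = y then g i else f (w, i)) (w, 0) = w"
        using g(2) 2(3) by auto
      ultimately show ?thesis by blast
    qed
    then show ?thesis by blast
  qed simp
qed

section \<open>The extremal trees for \<open>d = 2\<close>\<close>

text \<open>Root the tree and let \<open>c\<close> be the parent of a vertex of maximal level. All
  children of \<open>c\<close> have maximal level and so are leaves. Either \<open>c\<close> is the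
  root and the tree is a star, or the parent of \<open>c\<close> serves as \<open>v\<close>.\<close>

lemma tree_end_star:
  assumes T: "tree_on V E" and V: "2 \<le> card V"
  shows "(\<exists>c \<in> V. \<forall>x \<in> V. x = c \<or> (x, c) \<in> E) \<or>
    (\<exists>c v. (v, c) \<in> E \<and> (\<exists>z. (c, z) \<in> E \<and> z \<noteq> v) \<and>
      (\<forall>z w. (c, z) \<in> E \<longrightarrow> z \<noteq> v \<longrightarrow> (z, w) \<in> E \<longrightarrow> w = c))"
proof -
  obtain r where r: "r \<in> V" using tree_on_basic(2)[OF T] by blast
  from tree_on_imp_rooted_tree[OF T r] obtain p l where R: "rooted_tree V E r p l" by blast
  note RD = rooted_treeD[OF R]
  have "Max (l ` V) \<in> l ` V" using RD(1,2) by (intro Max_in) auto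
  then obtain x where x: "x \<in> V" "l x = Max (l ` V)" by force
  have mx: "l z \<le> l x" if "z \<in> V" for z using that x(2) RD(1) by simp
  have xr: "x \<noteq> r"
  proof
    assume "x = r"
    have "V \<noteq> {r}" using V by auto
    then obtain z where z: "z \<in> V" "z \<noteq> r" using r by blast
    then show False using RD(5)[OF z] mx[OF z(1)] RD(3) \<open>x = r\<close> by simp
  qed
  define c where "c = p x"
  have c: "c \<in> V" "l x = Suc (l c)" using RD(4,5)[OF x(1) xr] by (auto simp: c_def)
  have below: "w = c" if z: "z \<in> V" "z \<noteq> r" "p z = c" and zw: "(z, w) \<in> E" for z w
  proof (rule ccontr)
    assume "w \<noteq> c"
    then have "w \<in> V" "w \<noteq> r" "p w = z" using zw z(3) RD(6)[of z w] by auto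
    then have "l w = Suc (Suc (l c))" using RD(5) z by metis
    then show False using mx[OF \<open>w \<in> V\<close>] c(2) by simp
  qed
  show ?thesis
  proof (cases "c = r")
    case True
    have "y = c \<or> (y, c) \<in> E" if y: "y \<in> V" for y
    proof (cases "y = c")
      case False
      then have "l y = Suc (l (p y))" "p y \<in> V" using RD(4,5)[OF y] True by auto
      then have "l (p y) = 0" using mx[OF y] c(2) RD(3) True by simp
      then have "p y = c" using rooted_tree_level_eq_0[OF R \<open>p y \<in> V\<close>] True by simp
      then show ?thesis using RD(6) y c(1) False True by auto
    qed simp
    then show ?thesis using c(1) by blast
  next
    case False
    define v where "v = p c"
    have v: "(v, c) \<in> E" "v \<in> V" "l c = Suc (l v)" using RD(4-6) c(1) False by (auto simp: v_def)
    have "(c, x) \<in> E" using RD(6) x(1) c(1) xr c_def by auto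
    moreover have "x \<noteq> v" using c(2) v(3) by auto
    moreover have "w = c" if "(c, z) \<in> E" "z \<noteq> v" "(z, w) \<in> E" for z w
      using below[of z w] that RD(6)[of c z] by (auto simp: v_def)
    ultimately show ?thesis using v(1) by blast
  qed
qed

text \<open>The root separates the branches and is not selected, so sets chosen in the branches
  remain independent together. The root itself is dominated by the child \<open>c\<close>, which is
  selected in its own branch.\<close>

lemma rooted_tree_branch_union:
  assumes R: "rooted_tree V E r p l"
    and sub: "\<And>b. b \<in> V - {r} \<Longrightarrow> p b = r \<Longrightarrow> sel b \<subseteq> desc V r p b"
    and ind: "\<And>b. b \<in> V - {r} \<Longrightarrow> p b = r \<Longrightarrow> E \<inter> sel b \<times> sel b = {}"
    and dom: "\<And>b. b \<in> V - {r} \<Longrightarrow> p b = r \<Longrightarrow> walk_dominating 1 (desc V r p b) E (sel b)"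
    and c: "c \<in> V - {r}" "p c = r" "c \<in> sel c"
  shows "indep_dominating 1 V E (\<Union>b \<in> {b \<in> V - {r}. p b = r}. sel b)"
proof -
  note RD = rooted_treeD[OF R]
  let ?C = "{b \<in> V - {r}. p b = r}"
  let ?D = "\<Union>b \<in> ?C. sel b"
  show ?thesis
    unfolding indep_dominating_def
  proof (intro conjI)
    show "?D \<subseteq> V" using sub desc_subset by fast
    have "(x, y) \<notin> E" if x: "x \<in> sel a" "a \<in> ?C" and y: "y \<in> sel b" "b \<in> ?C" for x y a b
    proof (cases "a = b")
      case True
      then show ?thesis using ind[of a] x y by auto
    next
      case False
      have da: "x \<in> desc V r p a" and db: "y \<in> desc V r p b" using sub x y by auto
      show ?thesis
      proof
        assume "(x, y) \<in> E"
        moreover have "y \<notin> desc V r p a"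
          using desc_child_disjoint[OF R _ db, of a] x(2) y(2) False by auto
        ultimately have "y = r" using desc_edge_cut[OF R _ da] x(2) by auto
        then show False using desc_level[OF R db] RD(3) RD(5)[of b] y(2) by auto
      qed
    qed
    then show "E \<inter> ?D \<times> ?D = {}" by blast
    show "walk_dominating 1 V E ?D"
      unfolding walk_dominating_def
    proof
      fix x assume "x \<in> V"
      show "\<exists>y\<in>?D. \<exists>n\<le>1. (x, y) \<in> E ^^ n"
      proof (cases "x = r")
        case True
        have "(r, c) \<in> E" using RD(2,6) c by auto
        then have "(x, c) \<in> E ^^ 1" using True by simp
        then show ?thesis using c by blast
      next
        case False
        have "x \<in> desc V r p r" using desc_root[OF R] \<open>x \<in> V\<close> by simp
        then obtain b where "b \<in> V - {r}" "p b = r" "x \<in> desc V r p b"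
          using desc_child_cover[OF R _ False] by blast
        then show ?thesis using dom[of b] unfolding walk_dominating_def by blast
      qed
    qed
  qed
qed

lemma rooted_tree_card_branches:
  assumes R: "rooted_tree V E r p l"
  shows "card V = Suc (\<Sum>b \<in> {b \<in> V - {r}. p b = r}. card (desc V r p b))"
proof -
  note RD = rooted_treeD[OF R]
  let ?C = "{b \<in> V - {r}. p b = r}"
  have fin: "finite (desc V r p b)" for b using desc_subset RD(1) finite_subset by metis
  have "V - {r} = (\<Union>b \<in> ?C. desc V r p b)"
  proof
    show "V - {r} \<subseteq> (\<Union>b \<in> ?C. desc V r p b)"
      using desc_child_cover[OF R, of _ r] desc_root[OF R] by blast
    have "r \<notin> desc V r p b" if "b \<in> ?C" for b
      using desc_level[OF R, of r b] RD(3) RD(5)[of b] that by auto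
    then show "(\<Union>b \<in> ?C. desc V r p b) \<subseteq> V - {r}" using desc_subset by fast
  qed
  then have "card (V - {r}) = card (\<Union>b \<in> ?C. desc V r p b)" by (rule arg_cong)
  also have "\<dots> = (\<Sum>b \<in> ?C. card (desc V r p b))"
  proof (rule card_UN_disjoint)
    show "\<forall>i\<in>?C. \<forall>j\<in>?C. i \<noteq> j \<longrightarrow> desc V r p i \<inter> desc V r p j = {}"
      using desc_child_disjoint[OF R] by blast
  qed (use RD(1) fin in auto)
  finally show ?thesis using card_Suc_Diff1[OF RD(1,2)] by simp
qed

text \<open>
  If \<open>v\<close> had too few leaf neighbours, then \<open>c\<close>, these leaves and at most half of every other
  branch at \<open>v\<close> would form a dominating set that is too small.
\<close>

lemma tight_leaf_count:
  assumes T: "tree_on V E"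
    and tight: "\<And>D. indep_dominating 1 V E D \<Longrightarrow> card V \<le> 2 * card D"
    and vc: "(v, c) \<in> E" and z0: "(c, z0) \<in> E" "z0 \<noteq> v"
    and A: "\<And>z w. (c, z) \<in> E \<Longrightarrow> z \<noteq> v \<Longrightarrow> (z, w) \<in> E \<Longrightarrow> w = c"
  shows "card {z. (c, z) \<in> E \<and> z \<noteq> v} \<le> card {z. (v, z) \<in> E \<and> (\<forall>w. (z, w) \<in> E \<longrightarrow> w = v)}"
proof (rule ccontr)
  define A' where "A' = {z. (c, z) \<in> E \<and> z \<noteq> v}"
  define L where "L = {z. (v, z) \<in> E \<and> (\<forall>w. (z, w) \<in> E \<longrightarrow> w = v)}"
  assume "\<not> ?thesis"
  then have less: "card L < card A'" by (simp add: A'_def L_def)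
  have v: "v \<in> V" and cV: "c \<in> V" using vc tree_on_basic(3)[OF T] by auto
  have cv: "c \<noteq> v" using vc tree_on_basic(5)[OF T] by (auto simp: irrefl_def)
  from tree_on_imp_rooted_tree[OF T v] obtain p l where R: "rooted_tree V E v p l" by blast
  note RD = rooted_treeD[OF R]
  define Ch where "Ch = {b \<in> V - {v}. p b = v}"
  have Ch_iff: "b \<in> Ch \<longleftrightarrow> (v, b) \<in> E" for b
    using RD(2,6) tree_on_basic(5)[OF T] by (auto simp: Ch_def irrefl_def)
  have c: "c \<in> Ch" "c \<notin> L" using Ch_iff vc z0 by (auto simp: L_def)
  have LCh: "L \<subseteq> Ch" using Ch_iff by (auto simp: L_def)
  have fin: "finite Ch" "finite L" "finite A'"
    using RD(1) finite_subset[of A' V] finite_subset[OF LCh] tree_on_basic(3)[OF T]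
    by (auto simp: Ch_def A'_def)
  have pA: "p z = c" if "z \<in> A'" for z
    using that RD(6)[of c z] c(1) by (auto simp: A'_def Ch_def)
  have desc_c: "desc V v p c = insert c A'"
  proof
    show "desc V v p c \<subseteq> insert c A'"
    proof
      fix x assume "x \<in> desc V v p c"
      then show "x \<in> insert c A'"
      proof (induction rule: desc.induct)
        case (child x)
        then have "(p x, x) \<in> E" using RD(4,6) by auto
        then show ?case using child A[of "p x" x] by (auto simp: A'_def)
      qed simp
    qed
    have "A' \<subseteq> V - {v}" using tree_on_basic(3)[OF T] by (auto simp: A'_def)
    then show "insert c A' \<subseteq> desc V v p c" using pA cV by (auto intro: desc.intros)
  qed
  have "c \<notin> A'" using tree_on_basic(5)[OF T] by (auto simp: A'_def irrefl_def)
  then have card_c: "card (desc V v p c) = Suc (card A')" using fin(3) by (simp add: desc_c)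
  have desc_L: "desc V v p b = {b}" if "b \<in> L" for b
  proof
    show "desc V v p b \<subseteq> {b}"
    proof
      fix x assume "x \<in> desc V v p b"
      then show "x \<in> {b}"
      proof (induction rule: desc.induct)
        case (child x)
        then have "(b, x) \<in> E" using RD(4)[of x] RD(6)[of b x] by auto
        then have "x = v" using that by (auto simp: L_def)
        then show ?case using child.hyps by simp
      qed simp
    qed
    show "{b} \<subseteq> desc V v p b" using that LCh by (auto simp: Ch_def intro: desc.self)
  qed
  \<comment> \<open>A branch that is neither that of \<open>c\<close> nor a single leaf has at least
    two vertices, so the upper bound for d = 2 provides a set of at most half its order.\<close>
  have "\<exists>D. D \<subseteq> desc V v p b \<and> E \<inter> D \<times> D = {} \<and> walk_dominating 1 (desc V v p b) E D \<and>
      2 * card D \<le> card (desc V v p b)"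
    if b: "b \<in> Ch" "b \<noteq> c" "b \<notin> L" for b
  proof -
    let ?B = "desc V v p b"
    have bV: "b \<in> V" "b \<noteq> v" "p b = v" using b by (auto simp: Ch_def)
    have TB: "tree_on ?B (E \<inter> ?B \<times> ?B)"
      using rooted_tree_imp_tree_on[OF rooted_tree_desc[OF R bV(1)]] .
    obtain w where w: "(b, w) \<in> E" "w \<noteq> v" using b Ch_iff by (auto simp: L_def)
    then have "w \<in> V" "p w = b" using RD(6)[of b w] bV by auto
    then have "{b, w} \<subseteq> ?B" using w(2) bV(1) by (auto intro: desc.intros)
    moreover have "b \<noteq> w" using w(1) tree_on_basic(5)[OF T] by (auto simp: irrefl_def)
    moreover have "finite ?B" using tree_on_basic(1)[OF TB] .
    ultimately have "2 \<le> card ?B" using card_mono[of ?B "{b, w}"] by simp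
    then obtain D where D: "indep_dominating 1 ?B (E \<inter> ?B \<times> ?B) D" "2 * card D \<le> card ?B"
      using tree_indep_dominating[OF TB, of 2] by auto
    then have "walk_dominating 1 ?B E D" "D \<subseteq> ?B" "E \<inter> D \<times> D = {}"
      by (auto simp: indep_dominating_def intro: walk_dominating_mono)
    then show ?thesis using D(2) by blast
  qed
  then obtain s where s: "s b \<subseteq> desc V v p b \<and> E \<inter> s b \<times> s b = {} \<and>
      walk_dominating 1 (desc V v p b) E (s b) \<and> 2 * card (s b) \<le> card (desc V v p b)"
    if "b \<in> Ch" "b \<noteq> c" "b \<notin> L" for b
    by metis
  define sel where "sel b = (if b = c \<or> b \<in> L then {b} else s b)" for b
  have "walk_dominating 1 (desc V v p c) E {c}"
    unfolding walk_dominating_def desc_c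
  proof
    fix x assume "x \<in> insert c A'"
    then have "(x, c) \<in> E ^^ 0 \<or> (x, c) \<in> E ^^ 1"
      using tree_on_symD[OF T] by (auto simp: A'_def)
    then show "\<exists>y\<in>{c}. \<exists>n\<le>1. (x, y) \<in> E ^^ n" by (metis le_numeral_extra(3,4) zero_le singletonI)
  qed
  moreover have "walk_dominating 1 (desc V v p b) E {b}" if "b \<in> L" for b
    using desc_L[OF that] by (auto simp: walk_dominating_def intro: exI[of _ 0])
  moreover have "(b, b) \<notin> E" for b using tree_on_basic(5)[OF T] by (auto simp: irrefl_def)
  ultimately have sel: "sel b \<subseteq> desc V v p b" "E \<inter> sel b \<times> sel b = {}"
    "walk_dominating 1 (desc V v p b) E (sel b)" if "b \<in> V - {v}" "p b = v" for b
    using s[of b] that by (auto simp: sel_def Ch_def intro: desc.self)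
  have D: "indep_dominating 1 V E (\<Union>b \<in> Ch. sel b)"
    unfolding Ch_def
    by (rule rooted_tree_branch_union[OF R sel, of c]) (use c(1) in \<open>auto simp: Ch_def sel_def\<close>)
  have fs: "finite (sel b)" if "b \<in> Ch" for b
    using sel(1)[of b] that desc_subset[of V v p b] RD(1) by (auto simp: Ch_def intro: finite_subset)
  have "card (\<Union>b \<in> Ch. sel b) \<le> (\<Sum>b \<in> Ch. card (sel b))"
    using fin(1) by (rule card_UN_le)
  also have "\<dots> = 1 + (\<Sum>b \<in> Ch - {c}. card (sel b))"
    using fin(1) c(1) by (subst sum.remove[of _ c]) (auto simp: sel_def)
  finally have le: "2 * card (\<Union>b \<in> Ch. sel b) \<le> 2 + (\<Sum>b \<in> Ch - {c}. 2 * card (sel b))"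
    by (simp add: sum_distrib_left[symmetric])
  \<comment> \<open>Twice the selected set is compared with the order of \<open>V\<close>. A branch
    in \<open>L\<close> exceeds its order by 1, other branches do not exceed theirs, and
    \<open>c\<close> costs 2 where \<open>v\<close> and the branch of \<open>c\<close> contribute
    \<open>card A'\<close> + 2 vertices. Tightness would give \<open>card A'\<close> \<le>
    \<open>card L\<close>.\<close>
  have "(\<Sum>b \<in> Ch - {c}. 2 * card (sel b)) \<le> (\<Sum>b \<in> Ch - {c}. card (desc V v p b) + (if b \<in> L then 1 else 0))"
    using s desc_L by (intro sum_mono) (auto simp: sel_def)
  also have "\<dots> = (\<Sum>b \<in> Ch - {c}. card (desc V v p b)) + card L"
  proof -
    have "(Ch - {c}) \<inter> L = L" using LCh c by auto
    then show ?thesis using fin(1) by (simp add: sum.distrib sum.If_cases)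
  qed
  finally have le2: "(\<Sum>b \<in> Ch - {c}. 2 * card (sel b)) \<le> (\<Sum>b \<in> Ch - {c}. card (desc V v p b)) + card L" .
  have "card V = Suc (\<Sum>b \<in> Ch. card (desc V v p b))"
    unfolding Ch_def by (rule rooted_tree_card_branches[OF R])
  also have "(\<Sum>b \<in> Ch. card (desc V v p b)) = Suc (card A') + (\<Sum>b \<in> Ch - {c}. card (desc V v p b))"
    using fin(1) c(1) card_c by (subst sum.remove[of _ c]) auto
  finally show False using tight[OF D] le le2 less by linarith
qed

text \<open>Besides the star at \<open>c\<close>, only \<open>card A\<close> - 1 of the leaves at
  \<open>v\<close> are removed, so that a further leaf \<open>z1\<close> keeps \<open>v\<close> a
  support vertex. The rest is tight again: any set for it extends by exactly \<open>card A\<close>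
  vertices, and twice as many vertices were removed.\<close>

lemma tight_imp_zeta1:
  assumes "tree_on V E" "2 \<le> card V"
    and "\<And>D. indep_dominating 1 V E D \<Longrightarrow> card V \<le> 2 * card D"
  shows "\<lparr>pverts = V, parcs = E\<rparr> \<in> zeta1"
  using assms
proof (induction "card V" arbitrary: V E rule: less_induct)
  case less
  note T = less.prems(1) and tight = less.prems(3)
  have finV: "finite V" and EV: "E \<subseteq> V \<times> V" using tree_on_basic[OF T] by auto
  have irr: "(x, x) \<notin> E" for x using tree_on_basic(5)[OF T] by (auto simp: irrefl_def)
  note sym = tree_on_symD[OF T]
  from tree_end_star[OF T less.prems(2)] consider
    c where "c \<in> V" "\<forall>x \<in> V. x = c \<or> (x, c) \<in> E"
    | c v where "(v, c) \<in> E" "\<exists>z. (c, z) \<in> E \<and> z \<noteq> v"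
      "\<And>z w. (c, z) \<in> E \<Longrightarrow> z \<noteq> v \<Longrightarrow> (z, w) \<in> E \<Longrightarrow> w = c"
    by blast
  then show ?case
  proof cases
    case (1 c)
    \<comment> \<open>In a star the centre alone dominates, and tightness leaves only two
      vertices.\<close>
    have "walk_dominating 1 V E {c}"
      unfolding walk_dominating_def
    proof
      fix x assume "x \<in> V"
      then have "(x, c) \<in> E ^^ 0 \<or> (x, c) \<in> E ^^ 1" using 1 by auto
      then show "\<exists>y\<in>{c}. \<exists>n\<le>1. (x, y) \<in> E ^^ n" by (metis le_numeral_extra(3,4) zero_le singletonI)
    qed
    then have "indep_dominating 1 V E {c}" using 1(1) irr by (auto simp: indep_dominating_def)
    then have "card V = 2" using tight[of "{c}"] less.prems(2) by simp
    then obtain a b where ab: "V = {a, b}" "a \<noteq> b" by (auto simp: card_2_iff)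
    have "(a, b) \<in> E" "(b, a) \<in> E" using 1 ab sym by auto
    then have "E = {(x, y). (x, y) \<in> V \<times> V \<and> x \<noteq> y}" using EV irr ab by auto
    then have "complete_digraph 2 (with_proj \<lparr>pverts = V, parcs = E\<rparr>)"
      using \<open>card V = 2\<close> finV by (simp add: complete_digraph_pair_def)
    then show ?thesis by (rule zeta1.base)
  next
    case (2 c v)
    define A where "A = {z. (c, z) \<in> E \<and> z \<noteq> v}"
    define L where "L = {z. (v, z) \<in> E \<and> (\<forall>w. (z, w) \<in> E \<longrightarrow> w = v)}"
    have AV: "A \<subseteq> V" "L \<subseteq> V" using EV by (auto simp: A_def L_def)
    then have fin: "finite A" "finite L" using finV finite_subset by auto
    have ne: "A \<noteq> {}" using 2(2) by (auto simp: A_def)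
    have "card A \<le> card L"
    proof -
      obtain z0 where "(c, z0) \<in> E" "z0 \<noteq> v" using 2(2) by blast
      from tight_leaf_count[OF T tight 2(1) this 2(3)] show ?thesis unfolding A_def L_def .
    qed
    then obtain B where B: "B \<subseteq> L" "card B = card A - 1"
      using obtain_subset_with_card_n[of "card A - 1" L] by (metis diff_le_self le_trans)
    have t: "1 \<le> card A" using ne fin by (simp add: Suc_le_eq card_gt_0_iff)
    have finB: "finite B" using B(1) fin(2) by (rule finite_subset)
    have "\<not> L \<subseteq> B" using card_mono[OF finB, of L] B t \<open>card A \<le> card L\<close> by auto
    then obtain z1 where z1: "z1 \<in> L" "z1 \<notin> B" by auto
    have nA: "w = c" if "z \<in> A" "(z, w) \<in> E" for z w using 2(3) that by (auto simp: A_def)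
    have nL: "w = v" if "z \<in> L" "(z, w) \<in> E" for z w using that by (auto simp: L_def)
    have nc: "w = v \<or> w \<in> A" if "(c, w) \<in> E" for w using that by (auto simp: A_def)
    have vcz: "c \<noteq> v" "v \<in> V" "c \<in> V" using 2(1) irr EV by auto
    have cL: "c \<notin> L" "c \<notin> A" "v \<notin> A" "v \<notin> L"
    proof -
      obtain a where "(c, a) \<in> E" "a \<noteq> v" using 2(2) by blast
      then show "c \<notin> L" using nL by blast
    qed (use irr in \<open>auto simp: A_def L_def\<close>)
    have AL: "A \<inter> L = {}"
    proof -
      have "a \<notin> L" if "a \<in> A" for a
      proof
        assume "a \<in> L"
        have "(a, c) \<in> E" using that sym by (simp add: A_def)
        then show False using nL[OF \<open>a \<in> L\<close>] vcz(1) by blast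
      qed
      then show ?thesis by blast
    qed
    define N where "N = {c} \<union> A \<union> B"
    have cardN: "card N = 2 * card A"
    proof -
      have "card N = card {c} + card A + card B"
        unfolding N_def using fin finB cL AL B(1) by (subst card_Un_disjoint; auto)+
      then show ?thesis using B(2) t by simp
    qed
    have NV: "N \<subseteq> V" "finite N" using AV B(1) vcz fin(1) finB by (auto simp: N_def)
    define V' where "V' = V - N"
    define E' where "E' = E \<inter> V' \<times> V'"
    have cV: "card V = card V' + 2 * card A"
      unfolding V'_def using NV finV cardN card_mono[OF finV NV(1)] by (simp add: card_Diff_subset)
    have vV: "v \<in> V'" "z1 \<in> V'" using vcz cL B(1) z1 AV AL by (auto simp: V'_def N_def)
    have "tree_on V' E'"
    proof -
      from tree_on_imp_rooted_tree[OF T vcz(2)] obtain p l where R: "rooted_tree V E v p l" by blast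
      note RD = rooted_treeD[OF R]
      have "rooted_tree V' E' v p l"
        unfolding E'_def
      proof (rule rooted_tree_restrict[OF R])
        fix x assume x: "x \<in> V'" "x \<noteq> v"
        then have xV: "x \<in> V" "(p x, x) \<in> E" using RD(4,6) by (auto simp: V'_def)
        have "p x \<notin> N"
          using xV(2) nA[of "p x" x] nL[of "p x" x] nc[of x] x B(1) by (auto simp: N_def V'_def)
        then show "p x \<in> V'" using RD(4)[OF xV(1) x(2)] by (simp add: V'_def)
      qed (use vV in \<open>auto simp: V'_def\<close>)
      then show ?thesis by (rule rooted_tree_imp_tree_on)
    qed
    moreover have "2 \<le> card V'"
    proof -
      have "z1 \<noteq> v" using z1 cL by auto
      then have "card {z1, v} = 2" by simp
      moreover have "finite V'" using finV by (simp add: V'_def)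
      ultimately show ?thesis using card_mono[of V' "{z1, v}"] vV by simp
    qed
    moreover have "card V' \<le> 2 * card D" if D: "indep_dominating 1 V' E' D" for D
    proof -
      have DV: "D \<subseteq> V'" "E \<inter> D \<times> D = {}" "walk_dominating 1 V' E' D"
        using D by (auto simp: indep_dominating_def E'_def)
      have domV': "walk_dominating 1 V' E (D \<union> X)" for X
        using DV(3) by (rule walk_dominating_mono) (auto simp: E'_def)
      have finD: "finite D" using DV(1) finV finite_subset by (auto simp: V'_def)
      have near: "\<exists>y\<in>Y. \<exists>n\<le>1. (x, y) \<in> E ^^ n" if "x \<in> Y \<or> (\<exists>y \<in> Y. (x, y) \<in> E)" for x Y
      proof -
        from that obtain y where "y \<in> Y" "(x, y) \<in> E ^^ 0 \<or> (x, y) \<in> E ^^ 1" by auto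
        then show ?thesis by (metis le_numeral_extra(3,4) zero_le)
      qed
      \<comment> \<open>If \<open>v\<close> is selected, it dominates \<open>B\<close>, and
        \<open>A\<close> covers itself and \<open>c\<close>. Otherwise \<open>c\<close> covers
        \<open>A\<close>, and \<open>B\<close> is taken in full. Either set has
        \<open>card A\<close> elements and no neighbour in \<open>D\<close>.\<close>
      define X where "X = (if v \<in> D then A else insert c B)"
      have XN: "X \<subseteq> N" by (auto simp: X_def N_def)
      have cardX: "card X = card A"
        using finB B cL t by (auto simp: X_def card_insert_if)
      have nX: "(a, b) \<notin> E" if "a \<in> X" "b \<in> D \<union> X" for a b
      proof
        assume ab: "(a, b) \<in> E"
        show False
        proof (cases "v \<in> D")
          case True
          then have "b = c" using that nA ab by (simp add: X_def)
          then show False using that True DV(1) cL by (auto simp: X_def V'_def N_def)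
        next
          case False
          have "b \<notin> A" using that False DV(1) cL AL B(1) by (auto simp: X_def V'_def N_def)
          then have "b = v" using that nL nc ab False B(1) by (auto simp: X_def)
          then show False using that False vcz cL B(1) by (auto simp: X_def)
        qed
      qed
      have "indep_dominating 1 V E (D \<union> X)"
        unfolding indep_dominating_def
      proof (intro conjI)
        show "D \<union> X \<subseteq> V" using DV(1) XN NV by (auto simp: V'_def)
        show "E \<inter> (D \<union> X) \<times> (D \<union> X) = {}" using DV(2) nX sym by blast
        have "walk_dominating 1 N E (D \<union> X)"
          unfolding walk_dominating_def
        proof
          fix x assume x: "x \<in> N"
          show "\<exists>y\<in>D \<union> X. \<exists>n\<le>1. (x, y) \<in> E ^^ n"
          proof (rule near)
            obtain a where a: "a \<in> A" using ne by blast
            then have ca: "(c, a) \<in> E" by (simp add: A_def)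
            have xA: "(x, c) \<in> E" if "x \<in> A" using that sym[of c x] by (simp add: A_def)
            have xB: "(x, v) \<in> E" if "x \<in> B" using that B(1) sym[of v x] by (auto simp: L_def)
            show "x \<in> D \<union> X \<or> (\<exists>y\<in>D \<union> X. (x, y) \<in> E)"
            proof (cases "v \<in> D")
              case True
              then show ?thesis using x a ca xB unfolding X_def N_def by auto
            next
              case False
              then show ?thesis using x xA unfolding X_def N_def by auto
            qed
          qed
        qed
        moreover have "V = V' \<union> N" using NV by (auto simp: V'_def)
        ultimately show "walk_dominating 1 V E (D \<union> X)" using domV' by (simp add: walk_dominating_Un)
      qed
      then have "card V \<le> 2 * card (D \<union> X)" by (rule tight)
      also have "card (D \<union> X) = card D + card A"
        using finD XN NV(2) DV(1) finite_subset[OF XN] cardX by (subst card_Un_disjoint) (auto simp: V'_def)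
      finally show ?thesis using cV by simp
    qed
    moreover have "card V' < card V" using cV t by simp
    ultimately have Z: "\<lparr>pverts = V', parcs = E'\<rparr> \<in> zeta1" using less.hyps by blast
    have "v \<in> support_verts \<lparr>pverts = V', parcs = E'\<rparr>"
    proof -
      have vz: "(v, z1) \<in> E'" "(z1, v) \<in> E'" using z1 vV sym by (auto simp: L_def E'_def)
      moreover have "leaf E' z1"
        unfolding leaf_def using vz(2) nL[OF z1(1)] by (auto simp: E'_def)
      ultimately show ?thesis using vV by (auto simp: support_verts_def leaves_conv)
    qed
    then have "zeta_extension \<lparr>pverts = V', parcs = E'\<rparr> v c A B \<in> zeta1"
      by (rule zeta1.step[OF Z _ t fin(1) refl finB B(2)])
        (use cL AL B(1) in \<open>auto simp: V'_def N_def\<close>)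
    moreover have "zeta_extension \<lparr>pverts = V', parcs = E'\<rparr> v c A B = \<lparr>pverts = V, parcs = E\<rparr>"
    proof -
      define X where "X = {(v, c)} \<union> {c} \<times> A \<union> {v} \<times> B"
      have XE: "X \<subseteq> E" using 2(1) B(1) by (auto simp: X_def A_def L_def)
      have inX: "(a, b) \<in> X \<union> X\<inverse>" if "(a, b) \<in> E" "a \<in> N" for a b
        using that nA[of a b] nL[of a b] nc[of b] B(1) by (auto simp: N_def X_def)
      have "(a, b) \<in> E' \<union> X \<union> X\<inverse> \<longleftrightarrow> (a, b) \<in> E" for a b
      proof
        assume ab: "(a, b) \<in> E"
        then have "a \<in> V" "b \<in> V" using EV by auto
        then show "(a, b) \<in> E' \<union> X \<union> X\<inverse>"
          using inX[OF ab] inX[OF sym[OF ab]] ab by (auto simp: E'_def V'_def)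
      qed (use XE sym in \<open>auto simp: E'_def\<close>)
      then have "E' \<union> X \<union> X\<inverse> = E" by auto
      moreover have "V' \<union> {c} \<union> A \<union> B = V" using NV by (auto simp: V'_def N_def)
      ultimately show ?thesis by (simp add: zeta_extension_def X_def Let_def)
    qed
    ultimately show ?thesis by simp
  qed
qed

section \<open>The lower bound for \<open>zeta1\<close>\<close>

lemma zeta_extension_arcs:
  "parcs (zeta_extension G v c A B) =
     parcs G \<union> ({(v, c)} \<union> {c} \<times> A \<union> {v} \<times> B) \<union> ({(v, c)} \<union> {c} \<times> A \<union> {v} \<times> B)\<inverse>"
  "pverts (zeta_extension G v c A B) = pverts G \<union> {c} \<union> A \<union> B"
  by (auto simp: zeta_extension_def Let_def)

lemma complete_digraph_2_arcs:
  assumes "complete_digraph 2 (with_proj G)"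
  obtains a b where "pverts G = {a, b}" "a \<noteq> b" "parcs G = {(a, b), (b, a)}"
proof -
  from assms have "card (pverts G) = 2" "parcs G = {(u, v). (u, v) \<in> pverts G \<times> pverts G \<and> u \<noteq> v}"
    by (auto simp: complete_digraph_pair_def)
  then obtain a b where "pverts G = {a, b}" "a \<noteq> b" "parcs G = {(u, v). (u, v) \<in> pverts G \<times> pverts G \<and> u \<noteq> v}"
    by (auto simp: card_2_iff)
  then show ?thesis using that by fastforce
qed

text \<open>An extension gives \<open>v\<close> and \<open>c\<close> at least two neighbours each
  and attaches new leaves only to them, so adjacent leaves occur only in K_2. This settles when a
  support vertex can itself be a leaf.\<close>

lemma zeta1_leaves:
  assumes "G \<in> zeta1"
  shows "finite (pverts G) \<and> parcs G \<subseteq> pverts G \<times> pverts G \<and> sym (parcs G) \<and>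
    (complete_digraph 2 (with_proj G) \<or>
     (\<forall>x y. (x, y) \<in> parcs G \<longrightarrow> \<not> (leaf (parcs G) x \<and> leaf (parcs G) y)))"
  using assms
proof induction
  case (base G)
  then show ?case by (auto elim!: complete_digraph_2_arcs simp: sym_def)
next
  case (step G v t A B c)
  define E where "E = parcs (zeta_extension G v c A B)"
  have V: "v \<in> pverts G" using step.hyps by (simp add: support_verts_def)
  obtain u where u: "(v, u) \<in> parcs G" using step.hyps(2) by (auto simp: support_verts_def)
  have GV: "parcs G \<subseteq> pverts G \<times> pverts G" and sG: "sym (parcs G)" using step.IH by auto
  have E: "E = parcs G \<union> ({(v, c)} \<union> {c} \<times> A \<union> {v} \<times> B) \<union> ({(v, c)} \<union> {c} \<times> A \<union> {v} \<times> B)\<inverse>"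
    by (simp add: E_def zeta_extension_arcs)
  obtain a where a: "a \<in> A" using step.hyps by fastforce
  have "(c, v) \<in> E" "(c, a) \<in> E" "a \<noteq> v" using a V step.hyps unfolding E by auto
  then have nc: "\<not> leaf E c" unfolding leaf_def by blast
  have "(v, u) \<in> E" "(v, c) \<in> E" "u \<noteq> c" using u GV step.hyps unfolding E by auto
  then have nv: "\<not> leaf E v" unfolding leaf_def by blast
  have old: "(x, w) \<in> E \<longleftrightarrow> (x, w) \<in> parcs G" if "x \<in> pverts G" "x \<noteq> v" for x w
    using that step.hyps GV V unfolding E by auto
  have sE: "sym E" using sG unfolding E by (auto simp: sym_def)
  have ends: "x \<in> pverts G \<and> x \<noteq> v" if "(x, y) \<in> E" "leaf E x" "leaf E y" for x y
    using that nc nv GV unfolding E by auto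
  have "\<not> (leaf E x \<and> leaf E y)" if xy: "(x, y) \<in> E" for x y
  proof
    assume lf: "leaf E x \<and> leaf E y"
    have x: "x \<in> pverts G" "x \<noteq> v" and y: "y \<in> pverts G" "y \<noteq> v"
      using ends[OF xy] ends[of y x] lf xy sE by (auto dest: symD)
    then have "leaf (parcs G) x" "leaf (parcs G) y" "(x, y) \<in> parcs G"
      using lf xy old by (auto simp: leaf_def)
    then have "complete_digraph 2 (with_proj G)" using step.IH by blast
    then obtain a b where ab: "pverts G = {a, b}" "parcs G = {(a, b), (b, a)}"
      by (rule complete_digraph_2_arcs)
    then show False using x y V \<open>(x, y) \<in> parcs G\<close> by auto
  qed
  moreover have "E \<subseteq> pverts (zeta_extension G v c A B) \<times> pverts (zeta_extension G v c A B)"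
    using GV V unfolding E zeta_extension_arcs by auto
  ultimately show ?case using sE step.IH step.hyps unfolding E_def zeta_extension_arcs(2) by auto
qed

text \<open>\<open>X\<close> stands for the chosen core vertices, and \<open>Y\<close> adds the core
  vertices that have a chosen pendant leaf. Only \<open>X\<close> is independent and dominates its
  neighbours. Keeping the two sets apart gives a statement about the core alone that can be proved
  along the construction: each step adds 2 t vertices and at least t elements of
  \<open>Y\<close>.\<close>

lemma zeta1_lower_bound:
  assumes "G \<in> zeta1"
  shows "X \<subseteq> Y \<Longrightarrow> parcs G \<inter> X \<times> X = {} \<Longrightarrow>
    (\<And>u. u \<in> pverts G \<Longrightarrow> leaf (parcs G) u \<Longrightarrow> u \<in> Y \<or> (\<exists>w \<in> X. (u, w) \<in> parcs G)) \<Longrightarrow>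
    card (pverts G) \<le> 2 * card (Y \<inter> pverts G)"
  using assms
proof induction
  case (base G)
  then obtain a b where ab: "pverts G = {a, b}" "a \<noteq> b" "parcs G = {(a, b), (b, a)}"
    by (auto elim: complete_digraph_2_arcs)
  then have "leaf (parcs G) a" by (auto simp: leaf_def)
  then have "Y \<inter> pverts G \<noteq> {}" using base ab by fastforce
  then have "1 \<le> card (Y \<inter> pverts G)" using ab(1) by (simp add: Suc_le_eq card_gt_0_iff)
  moreover have "card (pverts G) = 2" using ab by simp
  ultimately show ?case by simp
next
  case (step G v t A B c)
  let ?G = "zeta_extension G v c A B"
  define E where "E = parcs ?G"
  have inv: "finite (pverts G)" "parcs G \<subseteq> pverts G \<times> pverts G"
    using zeta1_leaves[OF step.hyps(1)] by auto
  have V: "v \<in> pverts G" using step.hyps by (simp add: support_verts_def)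
  have E: "E = parcs G \<union> ({(v, c)} \<union> {c} \<times> A \<union> {v} \<times> B) \<union> ({(v, c)} \<union> {c} \<times> A \<union> {v} \<times> B)\<inverse>"
    by (simp add: E_def zeta_extension_arcs)
  have indep: "E \<inter> X \<times> X = {}" using step.prems(2) by (simp add: E_def)
  have leafY: "u \<in> Y \<or> (\<exists>w \<in> X. (u, w) \<in> E)" if "u \<in> pverts G \<union> {c} \<union> A \<union> B" "leaf E u" for u
    using step.prems(3)[of u] that by (simp add: E_def zeta_extension_arcs(2))
  have old: "(x, w) \<in> E \<longleftrightarrow> (x, w) \<in> parcs G" if "x \<in> pverts G" "x \<noteq> v" for x w
    using that step.hyps inv(2) V unfolding E by auto
  have nA: "(a, w) \<in> E \<longleftrightarrow> w = c" if "a \<in> A" for a w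
    using that step.hyps inv(2) V unfolding E by auto
  have nB: "(b, w) \<in> E \<longleftrightarrow> w = v" if "b \<in> B" for b w
    using that step.hyps inv(2) V unfolding E by auto
  have AY: "a \<in> Y \<or> c \<in> X" if "a \<in> A" for a
    using leafY[of a] nA[OF that] that by (auto simp: leaf_def)
  have BY: "b \<in> Y \<or> v \<in> X" if "b \<in> B" for b
    using leafY[of b] nB[OF that] that by (auto simp: leaf_def)
  have "card (pverts G) \<le> 2 * card (Y \<inter> pverts G)"
  proof (cases "leaf (parcs G) v")
    case True
    obtain u where u: "u \<in> pverts G" "leaf (parcs G) u" "(v, u) \<in> parcs G"
      using step.hyps(2) by (auto simp: support_verts_def leaves_conv)
    then have "complete_digraph 2 (with_proj G)" using zeta1_leaves[OF step.hyps(1)] True by blast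
    then obtain a b where ab: "pverts G = {a, b}" "a \<noteq> b" "parcs G = {(a, b), (b, a)}"
      by (rule complete_digraph_2_arcs)
    then have uv: "u \<noteq> v" "pverts G = {u, v}" using u by auto
    have "leaf E u" using u(2) old[OF u(1) uv(1)] by (simp add: leaf_def)
    then have "u \<in> Y \<or> (\<exists>w \<in> X. (u, w) \<in> parcs G)" using leafY[of u] u(1) old[OF u(1) uv(1)] by blast
    then have "Y \<inter> pverts G \<noteq> {}" using step.prems(1) inv(2) u(1) by blast
    then have "1 \<le> card (Y \<inter> pverts G)" using inv(1) by (simp add: Suc_le_eq card_gt_0_iff)
    moreover have "card (pverts G) = 2" using ab by simp
    ultimately show ?thesis by simp
  next
    case False
    show ?thesis
    proof (rule step.IH[OF step.prems(1)])
      show "parcs G \<inter> X \<times> X = {}" using indep unfolding E by blast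
      fix u assume u: "u \<in> pverts G" "leaf (parcs G) u"
      then have "u \<noteq> v" using False by auto
      then show "u \<in> Y \<or> (\<exists>w\<in>X. (u, w) \<in> parcs G)"
        using leafY[of u] u old[OF u(1)] by (simp add: leaf_def)
    qed
  qed
  moreover have "t \<le> card (Y \<inter> ({c} \<union> A \<union> B))"
  proof -
    have "\<exists>Z \<subseteq> Y \<inter> ({c} \<union> A \<union> B). card Z = t"
    proof (cases "A \<subseteq> Y")
      case True
      then show ?thesis using step.hyps by (intro exI[of _ A]) auto
    next
      case False
      \<comment> \<open>Some vertex of \<open>A\<close> is outside \<open>Y\<close>, so it needs
        \<open>c\<close>. Then \<open>v\<close> is excluded by independence, and all of
        \<open>B\<close> has to be in \<open>Y\<close>.\<close>
      then have c: "c \<in> X" using AY by auto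
      then have "v \<notin> X" using indep unfolding E by blast
      then have "B \<subseteq> Y" using BY by auto
      moreover have "card (insert c B) = t" using step.hyps by simp
      ultimately show ?thesis using c step.prems(1) by (intro exI[of _ "insert c B"]) auto
    qed
    then obtain Z where Z: "Z \<subseteq> Y \<inter> ({c} \<union> A \<union> B)" "card Z = t" by blast
    have "card Z \<le> card (Y \<inter> ({c} \<union> A \<union> B))" using Z(1) step.hyps by (intro card_mono) auto
    then show ?thesis using Z(2) by simp
  qed
  moreover have "card (Y \<inter> pverts ?G) = card (Y \<inter> pverts G) + card (Y \<inter> ({c} \<union> A \<union> B))"
  proof -
    have "Y \<inter> pverts ?G = (Y \<inter> pverts G) \<union> (Y \<inter> ({c} \<union> A \<union> B))"
      by (auto simp: zeta_extension_arcs)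
    then show ?thesis using inv(1) step.hyps by (simp add: card_Un_disjoint) (subst card_Un_disjoint; auto)
  qed
  moreover have "card (pverts ?G) \<le> card (pverts G) + 2 * t"
  proof -
    have "card (pverts ?G) \<le> card (pverts G) + card {c} + card A + card B"
      unfolding zeta_extension_arcs by (intro order_trans[OF card_Un_le] add_mono card_Un_le order_refl)
    then show ?thesis using step.hyps by simp
  qed
  ultimately show ?case by linarith
qed

section \<open>Removing the leaves\<close>

definition core :: "'a set \<Rightarrow> ('a \<times> 'a) set \<Rightarrow> 'a set" where
  "core V E = {v \<in> V. \<not> leaf E v}"

context
  fixes V :: "'a set" and E V' E'
  assumes T: "tree_on V E" and V': "V' = core V E" "V' \<noteq> {}" and E': "E' = E \<inter> V' \<times> V'"
begin

text \<open>A parent other than the root has two neighbours, a child and its own parent.\<close>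

lemma core_rooted_parent:
  assumes R: "rooted_tree V E r p l" and r: "r \<in> V'" and x: "x \<in> V" "x \<noteq> r"
  shows "p x \<in> V'"
proof (cases "p x = r")
  case False
  note RD = rooted_treeD[OF R]
  have px: "p x \<in> V" using RD(4) x by auto
  then have "(p x, x) \<in> E" "(p x, p (p x)) \<in> E" using RD(4,6) x False by auto
  moreover have "x \<noteq> p (p x)" using RD(5)[OF x] RD(5)[OF px False] by auto
  ultimately have "\<not> leaf E (p x)" unfolding leaf_def by blast
  then show ?thesis using px by (simp add: V' core_def)
qed (use r in simp)

lemma core_tree: "tree_on V' E'"
proof -
  obtain r where r: "r \<in> V'" using V' by blast
  then have rV: "r \<in> V" by (simp add: V' core_def)
  from tree_on_imp_rooted_tree[OF T rV] obtain p l where R: "rooted_tree V E r p l" by blast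
  have "rooted_tree V' (E \<inter> V' \<times> V') r p l"
    using core_rooted_parent[OF R r] r
    by (intro rooted_tree_restrict[OF R]) (auto simp: V' core_def)
  then show ?thesis unfolding E' by (rule rooted_tree_imp_tree_on)
qed

text \<open>A core vertex provides a root that is not a leaf, and the neighbour of a leaf is then
  its parent. With an empty core two leaves could be adjacent, as in K_2.\<close>

lemma leaf_neighbour_core:
  assumes "x \<in> V" "leaf E x" "(x, y) \<in> E"
  shows "y \<in> V'"
proof -
  obtain r where r: "r \<in> V'" using V' by blast
  then have rV: "r \<in> V" "x \<noteq> r" using assms by (auto simp: V' core_def)
  from tree_on_imp_rooted_tree[OF T rV(1)] obtain p l where R: "rooted_tree V E r p l" by blast
  have "(x, p x) \<in> E" using rooted_treeD(4,6)[OF R] assms(1) rV by auto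
  then have "y = p x" using assms by (auto simp: leaf_def)
  then show ?thesis using core_rooted_parent[OF R r assms(1) rV(2)] by simp
qed

text \<open>Such a vertex has at least two neighbours in the whole tree but only one in the core.
  The pendant leaves found here are what force both lower bounds.\<close>

lemma core_leaf_has_leaf:
  assumes "u \<in> V'" "leaf E' u"
  shows "\<exists>x \<in> V. leaf E x \<and> (u, x) \<in> E"
proof -
  obtain w where w: "(u, w) \<in> E'" "\<And>w'. (u, w') \<in> E' \<Longrightarrow> w' = w" using assms(2) unfolding leaf_def by metis
  have "\<not> leaf E u" using assms(1) by (simp add: V' core_def)
  then obtain x where x: "(u, x) \<in> E" "x \<noteq> w" using w(1) unfolding leaf_def E' by blast
  have "x \<notin> V'" using w(2) x assms(1) by (auto simp: E')
  moreover have "x \<in> V" using x tree_on_basic(3)[OF T] by auto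
  ultimately show ?thesis using x(1) by (auto simp: V' core_def)
qed

lemma indep_dominating_core:
  assumes "indep_dominating k V' E' D"
  shows "indep_dominating (Suc k) V E D"
proof -
  have D: "D \<subseteq> V'" "E' \<inter> D \<times> D = {}" "walk_dominating k V' E' D"
    using assms by (auto simp: indep_dominating_def)
  have EE: "E' \<subseteq> E" by (auto simp: E')
  have "walk_dominating (Suc k) V E D"
    unfolding walk_dominating_def
  proof
    fix x assume x: "x \<in> V"
    show "\<exists>y\<in>D. \<exists>n\<le>Suc k. (x, y) \<in> E ^^ n"
    proof (cases "x \<in> V'")
      case True
      then obtain y n where "y \<in> D" "n \<le> k" "(x, y) \<in> E' ^^ n" using D(3) by (auto simp: walk_dominating_def)
      then show ?thesis using relpow_mono[OF EE] by (meson le_SucI)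
    next
      case False
      then have lf: "leaf E x" using x by (simp add: V' core_def)
      then obtain z where z: "(x, z) \<in> E" by (auto simp: leaf_def)
      then have "z \<in> V'" using leaf_neighbour_core[OF x lf] by blast
      then obtain y n where y: "y \<in> D" "n \<le> k" "(z, y) \<in> E' ^^ n" using D(3) by (auto simp: walk_dominating_def)
      have "(x, y) \<in> E ^^ Suc n" using z relpow_mono[OF EE y(3)] by (rule relpow_Suc_I2)
      then show ?thesis using y by (meson Suc_le_mono)
    qed
  qed
  moreover have "D \<subseteq> V" using D(1) by (auto simp: V' core_def)
  moreover have "E \<inter> D \<times> D = {}" using D(1,2) by (auto simp: E')
  ultimately show ?thesis by (simp add: indep_dominating_def)
qed

text \<open>Moving every pendant leaf in \<open>D\<close> to its neighbour covers \<open>Y\<close>,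
  so \<open>Y\<close> is no larger than \<open>D\<close>. A pendant leaf at an end vertex
  \<open>u\<close> of the core has only \<open>u\<close> as neighbour; whatever dominates it within
  2 is the leaf itself, \<open>u\<close>, or a neighbour of \<open>u\<close>. In each case
  \<open>u\<close> is in \<open>Y\<close> or has a neighbour in \<open>X\<close>.\<close>

lemma zeta1_core_lower_bound:
  assumes Z: "\<lparr>pverts = V', parcs = E'\<rparr> \<in> zeta1" and D: "indep_dominating 2 V E D"
  shows "card V' \<le> 2 * card D"
proof -
  have DV: "D \<subseteq> V" "E \<inter> D \<times> D = {}" "walk_dominating 2 V E D"
    using D by (auto simp: indep_dominating_def)
  have finD: "finite D" using DV(1) tree_on_basic(1)[OF T] finite_subset by auto
  define X where "X = D \<inter> V'"
  define Y where "Y = X \<union> {u \<in> V'. \<exists>x \<in> D. leaf E x \<and> (x, u) \<in> E}"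
  define g where "g x = (if x \<in> V' then x else (THE u. (x, u) \<in> E))" for x
  have "Y \<subseteq> g ` D"
  proof
    fix u assume "u \<in> Y"
    then consider "u \<in> X" | x where "x \<in> D" "leaf E x" "(x, u) \<in> E" by (auto simp: Y_def)
    then show "u \<in> g ` D"
    proof cases
      case 1
      then have "g u = u" "u \<in> D" by (auto simp: X_def g_def)
      then show ?thesis by force
    next
      case (2 x)
      then have "x \<notin> V'" by (simp add: V' core_def)
      moreover have "(THE u. (x, u) \<in> E) = u" using 2 by (intro the_equality) (auto simp: leaf_def)
      ultimately have "g x = u" by (simp add: g_def)
      then show ?thesis using 2(1) by force
    qed
  qed
  then have "card (Y \<inter> V') \<le> card D"
    using finD by (meson Int_lower1 card_image_le card_mono finite_imageI order_trans)
  moreover have "card V' \<le> 2 * card (Y \<inter> V')"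
  proof -
    have "u \<in> Y \<or> (\<exists>w \<in> X. (u, w) \<in> E')" if u: "u \<in> V'" "leaf E' u" for u
    proof -
      obtain x where x: "x \<in> V" "leaf E x" "(u, x) \<in> E" using core_leaf_has_leaf[OF u] by blast
      have only: "w = u" if "(x, w) \<in> E" for w
        using that x tree_on_symD[OF T x(3)] by (auto simp: leaf_def)
      obtain y n where y: "y \<in> D" "n \<le> 2" "(x, y) \<in> E ^^ n" using DV(3) x(1) by (auto simp: walk_dominating_def)
      consider "n = 0" | "n = 1" | "n = 2" using y(2) by linarith
      then show ?thesis
      proof cases
        case 1
        then show ?thesis using y u x tree_on_symD[OF T x(3)] by (auto simp: Y_def)
      next
        case 2
        then have "y = u" using y(3) only by auto
        then show ?thesis using y(1) u(1) by (simp add: Y_def X_def)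
      next
        case 3
        then obtain w where "(x, w) \<in> E" "(w, y) \<in> E" using y(3) by (auto simp: numeral_2_eq_2)
        then have uy: "(u, y) \<in> E" using only by blast
        show ?thesis
        proof (cases "y \<in> V'")
          case True
          then show ?thesis using uy u(1) y(1) by (auto simp: X_def E')
        next
          case False
          then have "leaf E y" using y(1) DV(1) by (auto simp: V' core_def)
          then show ?thesis using y(1) u(1) tree_on_symD[OF T uy] by (auto simp: Y_def)
        qed
      qed
    qed
    then show ?thesis
      using zeta1_lower_bound[OF Z, of X Y] DV(2) by (auto simp: X_def Y_def E')
  qed
  ultimately show ?thesis by linarith
qed

text \<open>
  A leaf of the whole tree hanging at the end of one of the paths is at distance \<open>k + 1\<close> from
  the root of that path, so a vertex within this distance determines the path.
\<close>

lemma path_corona_core_lower_bound: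
  assumes C: "path_corona k V' E' W F f" and k: "1 \<le> k" and D: "indep_dominating (Suc k) V E D"
  shows "card V' \<le> Suc k * card D"
proof -
  have DV: "D \<subseteq> V" "walk_dominating (Suc k) V E D"
    using D by (auto simp: indep_dominating_def)
  have finD: "finite D" using DV(1) tree_on_basic(1)[OF T] finite_subset by auto
  have V'f: "V' = f ` (W \<times> {0..k})" and inj: "inj_on f (W \<times> {0..k})"
    using C by (auto simp: path_corona_def)
  have fV: "f (w, i) \<in> V'" if "w \<in> W" "i \<le> k" for w i using that by (auto simp: V'f)
  note arc = path_corona_arc_iff[OF C]
  \<comment> \<open>The branch of \<open>w\<close>: its path together with the leaves of the whole
    tree attached to that path.\<close>
  define br where "br w y \<longleftrightarrow> (\<exists>i \<le> k. y = f (w, i) \<or> leaf E y \<and> (f (w, i), y) \<in> E)" for w y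
  have "\<exists>y \<in> D. br w y" if w: "w \<in> W" for w
  proof -
    have e: "f (w, k) \<in> V'" using fV w by simp
    have "leaf E' (f (w, k))"
      unfolding leaf_def
    proof (intro ex1I)
      show "(f (w, k), f (w, k - 1)) \<in> E'" using arc[OF w w, of k "k - 1"] k by simp
      fix z assume z: "(f (w, k), z) \<in> E'"
      then obtain b j where "b \<in> W" "j \<le> k" "z = f (b, j)" by (auto simp: E' V'f)
      then show "z = f (w, k - 1)" using arc[of w b k j] w z k by auto
    qed
    then obtain x where x: "x \<in> V" "leaf E x" "(f (w, k), x) \<in> E"
      using core_leaf_has_leaf[OF e] by blast
    \<comment> \<open>After n steps from \<open>x\<close> the index on the path is at least k + 1 -
      n. The foot, the only exit to other paths, is thus reached at step k + 1 at the earliest, when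
      no step is left. The bound on a pendant leaf is weaker by 1, which the step back onto the path
      makes up for.\<close>
    have inv: "\<exists>i \<le> k. z = f (w, i) \<and> Suc k \<le> i + n \<or> leaf E z \<and> (f (w, i), z) \<in> E \<and> k \<le> i + n"
      if "(x, z) \<in> E ^^ n" "n \<le> Suc k" for z n
      using that
    proof (induction n arbitrary: z)
      case 0
      then show ?case using x by auto
    next
      case (Suc n)
      then obtain y where y: "(x, y) \<in> E ^^ n" "(y, z) \<in> E" by auto
      then obtain i where i: "i \<le> k"
        "y = f (w, i) \<and> Suc k \<le> i + n \<or> leaf E y \<and> (f (w, i), y) \<in> E \<and> k \<le> i + n"
        using Suc by auto
      from i(2) show ?case
      proof
        assume y_def: "y = f (w, i) \<and> Suc k \<le> i + n"
        then have "0 < i" using Suc.prems(2) by simp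
        show ?thesis
        proof (cases "z \<in> V'")
          case True
          then obtain b j where bj: "b \<in> W" "j \<le> k" "z = f (b, j)" by (auto simp: V'f)
          have "(y, z) \<in> E'" using y(2) True y_def fV[OF w i(1)] by (simp add: E')
          then have "w = b \<and> (j = Suc i \<or> i = Suc j)"
            using arc[OF w bj(1) i(1) bj(2)] y_def bj(3) \<open>0 < i\<close> by auto
          then show ?thesis using bj y_def by (intro exI[of _ j]) auto
        next
          case False
          then have "leaf E z" using y(2) tree_on_basic(3)[OF T] by (auto simp: V' core_def)
          then show ?thesis using y(2) y_def i(1) by (intro exI[of _ i]) auto
        qed
      next
        assume y_def: "leaf E y \<and> (f (w, i), y) \<in> E \<and> k \<le> i + n"
        then have "z = f (w, i)" using y(2) tree_on_symD[OF T] by (auto simp: leaf_def)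
        then show ?thesis using i(1) y_def by (intro exI[of _ i]) auto
      qed
    qed
    obtain y n where "y \<in> D" "n \<le> Suc k" "(x, y) \<in> E ^^ n"
      using DV(2) x(1) by (auto simp: walk_dominating_def)
    then show ?thesis using inv[of y n] unfolding br_def by blast
  qed
  then obtain s where s: "\<And>w. w \<in> W \<Longrightarrow> s w \<in> D \<and> br w (s w)" by metis
  have br_uniq: "a = b" if ab: "br a y" "br b y" "a \<in> W" "b \<in> W" for a b y
  proof -
    obtain i j where ij: "i \<le> k" "j \<le> k" "y = f (a, i) \<or> leaf E y \<and> (f (a, i), y) \<in> E"
      "y = f (b, j) \<or> leaf E y \<and> (f (b, j), y) \<in> E"
      using ab(1,2) unfolding br_def by blast
    have "\<not> leaf E (f (a, i))" "\<not> leaf E (f (b, j))"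
      using fV ab(3,4) ij(1,2) by (auto simp: V' core_def)
    then have "f (a, i) = f (b, j)"
      using ij(3,4) tree_on_symD[OF T] unfolding leaf_def by blast
    then show ?thesis using inj_onD[OF inj] ab(3,4) ij(1,2) by fastforce
  qed
  have "inj_on s W" using br_uniq s by (metis inj_onI)
  then have "card W \<le> card D" using s finD by (intro card_inj_on_le) auto
  then show ?thesis using path_corona_card(1)[OF C] by (metis mult_le_mono2)
qed

end

lemma path_corona_family_iff:
  "G \<in> path_corona_family k \<longleftrightarrow>
    (\<exists>W F f. path_corona k (pverts G) (parcs G) (W :: 'a set) F f \<and> 2 \<le> card W)"
  for G :: "'a pair_pre_digraph"
proof -
  have wf: "pair_wf_digraph (attach_paths H k)" if "is_tree H" for H :: "'a pair_pre_digraph"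
  proof -
    have "parcs H \<subseteq> pverts H \<times> pverts H" using tree_on_basic(3) that is_tree_iff_tree_on by blast
    then show ?thesis by unfold_locales (auto simp: attach_paths_def)
  qed
  have verts: "pverts (attach_paths H k) = pverts H \<times> {0..k}" for H :: "'a pair_pre_digraph"
    by (simp add: attach_paths_def)
  show ?thesis
  proof
    assume "G \<in> path_corona_family k"
    then obtain H :: "'a pair_pre_digraph" where H: "is_tree H" "2 \<le> card (pverts H)"
      "digraph_iso (with_proj (attach_paths H k)) (with_proj G)"
      by (auto simp: path_corona_family_def)
    then obtain f where "inj_on f (pverts H \<times> {0..k})" "pverts G = f ` (pverts H \<times> {0..k})"
      "parcs G = map_prod f f ` parcs (attach_paths H k)"
      using digraph_iso_with_proj_iff[OF wf[OF H(1)]] verts by metis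
    moreover have "corona_arcs (pverts H) (parcs H) k = parcs (attach_paths H k)"
      by (simp add: attach_paths_def)
    ultimately have "path_corona k (pverts G) (parcs G) (pverts H) (parcs H) f"
      using H(1) by (simp add: path_corona_def is_tree_iff_tree_on)
    then show "\<exists>W F f. path_corona k (pverts G) (parcs G) (W :: 'a set) F f \<and> 2 \<le> card W"
      using H(2) by blast
  next
    assume "\<exists>W F f. path_corona k (pverts G) (parcs G) (W :: 'a set) F f \<and> 2 \<le> card W"
    then obtain W F f where C: "path_corona k (pverts G) (parcs G) (W :: 'a set) F f" "2 \<le> card W"
      by blast
    define H where "H = \<lparr>pverts = W, parcs = F\<rparr>"
    have H: "is_tree H" using C(1) by (simp add: is_tree_iff_tree_on H_def path_corona_def)
    then have "digraph_iso (with_proj (attach_paths H k)) (with_proj G)"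
      using digraph_iso_with_proj_iff[OF wf[OF H]] C(1) verts[of H] by (auto simp: path_corona_def H_def)
    then show "G \<in> path_corona_family k"
      using H C(2) by (auto simp: path_corona_family_def H_def)
  qed
qed

theorem theorem4p1:
  fixes T :: "'a pair_pre_digraph" and d n l :: nat
  assumes "d \<ge> 2"
    and "is_tree T"
    and "n = card (pverts T)"
    and "l = card (leaves T)"
    and "real n - real l \<ge> real d"
  shows "real (indep_dist_dom_number d T) \<le> (real n - real l) / real d \<and>
    (real (indep_dist_dom_number d T) = (real n - real l) / real d \<longleftrightarrow> T \<in> extremal_family d)"
proof -
  define V E where "V = pverts T" and "E = parcs T"
  have T: "tree_on V E" using assms(2) by (simp add: is_tree_iff_tree_on V_def E_def)
  define V' where "V' = core V E"
  define E' where "E' = E \<inter> V' \<times> V'"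
  define T' where "T' = \<lparr>pverts = V', parcs = E'\<rparr>"
  have finV: "finite V" and EV: "E \<subseteq> V \<times> V" using tree_on_basic[OF T] by auto
  have "V' = V - leaves T" by (auto simp: V'_def core_def leaves_conv V_def E_def)
  then have rem: "remove_verts T (leaves T) = T'"
    using EV by (auto simp: remove_verts_def T'_def E'_def V_def E_def)
  have "leaves T \<subseteq> V" by (auto simp: leaves_def V_def)
  then have "card V' = n - l" "l \<le> n"
    using \<open>V' = V - leaves T\<close> finV assms(3,4) card_mono[OF finV]
    by (auto simp: card_Diff_subset finite_subset V_def)
  then have m: "real n - real l = real (card V')" by simp
  then have d: "d \<le> card V'" using assms(5) by simp
  then have ne: "V' \<noteq> {}" using assms(1) by auto
  note core = T V'_def ne E'_def
  obtain k where k: "d = Suc k" "1 \<le> k" using assms(1) by (cases d) auto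
  have wf: "pair_wf_digraph T"
    using EV by unfold_locales (auto simp: V_def E_def)
  define g where "g = indep_dist_dom_number d T"
  have g: "g = (LEAST j. \<exists>S. indep_dominating d V E S \<and> card S = j)"
    using indep_dist_dominating_iff[OF wf] unfolding g_def indep_dist_dom_number_def V_def E_def
    by (metis (no_types, opaque_lifting))
  have T'tree: "tree_on V' E'" using core_tree[OF core] .
  have g_le: "g \<le> card D" if "indep_dominating k V' E' D" for D
    using indep_dominating_core[OF core that] unfolding g k(1) by (auto intro: Least_le)
  obtain D where D: "indep_dominating k V' E' D" "d * card D \<le> card V'"
    using tree_indep_dominating[OF T'tree assms(1) d] k(1) by auto
  obtain S where S: "indep_dominating d V E S" "card S = g"
  proof -
    have "\<exists>j S. indep_dominating d V E S \<and> card S = j"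
      using indep_dominating_core[OF core D(1)] k(1) by blast
    then have "\<exists>S. indep_dominating d V E S \<and> card S = g" unfolding g by (rule LeastI_ex)
    then show ?thesis using that by blast
  qed
  have le: "d * g \<le> card V'" using g_le[OF D(1)] D(2) by (meson le_trans mult_le_mono2)
  have "T \<in> extremal_family d \<longleftrightarrow> d * g = card V'"
  proof
    assume eq: "d * g = card V'"
    \<comment> \<open>A set for the core with radius d - 1 works for \<open>T\<close> with radius d,
      so it has at least \<open>g\<close> elements.\<close>
    have tight: "card V' \<le> Suc k * card D" if "indep_dominating k V' E' D" for D
      using g_le[OF that] eq k(1) by (metis mult_le_mono2)
    show "T \<in> extremal_family d"
    proof (cases "d = 2")
      case True
      then have "T' \<in> zeta1"
      proof -
        have "card V' \<le> 2 * card D" if "indep_dominating 1 V' E' D" for D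
          using tight[of D] that True k(1) by simp
        then show ?thesis using tight_imp_zeta1[OF T'tree] d True unfolding T'_def by blast
      qed
      then show ?thesis using True assms(2) by (simp add: extremal_family_def rem)
    next
      case False
      then have "card V' = Suc k \<or>
          (\<exists>W F f. path_corona k V' E' W F f \<and> 2 \<le> card W \<and> (\<forall>w \<in> W. f (w, 0) = w))"
        using tight_imp_path_corona[OF T'tree _ _ tight] d k by auto
      then have "card V' = d \<or> T' \<in> path_corona_family (d - 1)"
        unfolding path_corona_family_iff T'_def using k(1) by auto
      moreover have "is_tree T'" using T'tree by (simp add: is_tree_iff_tree_on T'_def)
      ultimately show ?thesis using False assms(2) by (auto simp: extremal_family_def rem T'_def)
    qed
  next
    assume ext: "T \<in> extremal_family d"
    have "card V' \<le> d * card S"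
    proof (cases "d = 2")
      case True
      then have "\<lparr>pverts = V', parcs = E'\<rparr> \<in> zeta1"
        using ext by (simp add: extremal_family_def rem T'_def)
      then show ?thesis using zeta1_core_lower_bound[OF core] S(1) True by simp
    next
      case False
      then consider "card V' = d" | "T' \<in> path_corona_family (d - 1)"
        using ext by (auto simp: extremal_family_def rem T'_def)
      then show ?thesis
      proof cases
        case 1
        \<comment> \<open>For a core of order d the bound asks for a single element.\<close>
        have "S \<noteq> {}" using S(1) tree_on_basic(2)[OF T] by (auto simp: indep_dominating_def walk_dominating_def)
        moreover have "finite S" using S(1) finV finite_subset by (auto simp: indep_dominating_def)
        ultimately have "1 \<le> card S" by (simp add: Suc_le_eq card_gt_0_iff)
        then show ?thesis using 1 by simp
      next
        case 2
        then obtain W F f where "path_corona k V' E' (W :: 'a set) F f"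
          unfolding path_corona_family_iff T'_def using k(1) by auto
        then show ?thesis using path_corona_core_lower_bound[OF core _ k(2)] S(1) k(1) by simp
      qed
    qed
    then show "d * g = card V'" using le S(2) by simp
  qed
  moreover have "real g = real (card V') / real d \<longleftrightarrow> d * g = card V'"
    using assms(1) by (simp add: field_simps flip: of_nat_mult)
  moreover have "real g \<le> real (card V') / real d"
    using le assms(1) by (simp add: field_simps flip: of_nat_mult)
  ultimately show ?thesis unfolding m g_def by simp
qed


end
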